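(* Let $\Gamma \subseteq Form$. Then the following are equivalent: (i) $\Gamma$ is consistent relative to the axiomatic system $\Sigma$; (ii) $\Gamma$ is satisfiable (at some moment-history pair) in a normal jstit model; (iii) $\Gamma$ is satisfiable in a normal unirelational jstit model.
   Context: Fix a finite nonempty set $Ag$ of agents and countably infinite, pairwise disjoint sets $PVar$ (proof variables), $PConst$ (proof constants) and $Var$ (propositional variables). Proof polynomials: $t ::= x \mid c \mid s+t \mid s\times t \mid\ !t$ ($x\in PVar$, $c\in PConst$); their set is $Pol$. Formulas: $A ::= p \mid A\wedge B \mid \neg A \mid [j]A \mid \Box A \mid t{:}A \mid KA \mid Et$ ($p\in Var$, $j\in Ag$, $t\in Pol$); their set is $Form$; $\Diamond=\neg\Box\neg$, other Boolean connectives are abbreviations. A jstit model is $\mathcal{M}=\langle Tree,\unlhd,Choice,Act,R,R_e,\mathcal{E},V\rangle$ where $Tree\neq\emptyset$ (moments); $\unlhd$ is a partial order on $Tree$ ($\lhd$ its strict part); histories are maximal $\unlhd$-chains, $H_m$ is the set of histories containing $m$, $MH=\{(m,h): h\in H_m\}$; for each $m$ and $j\in Ag$, $Choice^m_j$ is a partition of $H_m$, with $Choice^m_j(h)$ the cell containing $h$; $Act: MH\to 2^{Pol}$; $R\subseteq R_e$ are preorders on $Tree$; $\mathcal{E}:Tree\times Pol\to 2^{Form}$; $V:Var\to 2^{MH}$. Constraints: (1) any two moments have a common $\unlhd$-lower bound; (2) no backward branching: $m_1\unlhd m$ and $m_2\unlhd m$ imply $m_1\unlhd m_2$ or $m_2\unlhd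 m_1$; (3) if $h,h'\in H_m$ and some $m'\rhd m$ lies in $h\cap h'$ then $Choice^m_j(h)=Choice^m_j(h')$ for all $j$; (4) for every $m$ and every choice of cells $f(j)\in Choice^m_j$ ($j\in Ag$), $\bigcap_j f(j)\ne\emptyset$; (5) $R_e(m,m')$ implies $\mathcal{E}(m,t)\subseteq\mathcal{E}(m',t)$; (6) $A\to B\in\mathcal{E}(m,s)$ and $A\in\mathcal{E}(m,t)$ imply $B\in\mathcal{E}(m,s\times t)$; $\mathcal{E}(m,s)\cup\mathcal{E}(m,t)\subseteq\mathcal{E}(m,s+t)$; $A\in\mathcal{E}(m,t)$ implies $t{:}A\in\mathcal{E}(m,!t)$; (7) $m'\lhd m$ and $h\in H_m$ imply $Act(m',h)\subseteq Act(m,h)$; (8) $\bigcap_{h\in H_m}Act(m,h)\subseteq\bigcup_{m'\lhd m,\,h\in H_m}Act(m',h)$; (9) if $h,h'\in H_m$ and some $m'\rhd m$ lies in $h\cap h'$ then $Act(m,h)=Act(m,h')$; (10) $\unlhd\subseteq R$; (11) $R_e(m,m')$ implies $\bigcap_{h\in H_m}Act(m,h)\subseteq\bigcap_{h'\in H_{m'}}Act(m',h')$. Truth at $(m,h)\in MH$: $p$ iff $(m,h)\in V(p)$; Booleans standard; $[j]A$ iff $A$ holds at $(m,h')$ for all $h'\in Choice^m_j(h)$; $\Box A$ iff $A$ holds at $(m,h')$ for all $h'\in H_m$; $KA$ iff $A$ holds at all $(m',h')$ with $R(m,m')$, $h'\in H_{m'}$; $t{:}A$ iff $A\in\mathcal{E}(m,t)$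 and $A$ holds at all $(m',h')$ with $R_e(m,m')$, $h'\in H_{m'}$; $Et$ iff $t\in Act(m,h)$. A set is satisfiable in $\mathcal{M}$ if all its members hold at some $(m,h)\in MH$. A jstit model is unirelational if $R_e\subseteq R$ (so $R=R_e$). It is normal if for every $c\in PConst$ and $m\in Tree$, every instance of the schemes (A0)–(A9) below belongs to $\mathcal{E}(m,c)$. The system $\Sigma$ has axiom schemes: (A0) classical propositional tautologies; (A1) S5 axioms for $\Box$ and for each $[j]$; (A2) $\Box A\to[j]A$; (A3) $(\Diamond[j_1]A_1\wedge\dots\wedge\Diamond[j_n]A_n)\to\Diamond([j_1]A_1\wedge\dots\wedge[j_n]A_n)$ for pairwise distinct $j_1,\dots,j_n$; (A4) $s{:}(A\to B)\to(t{:}A\to(s\times t){:}B)$; (A5) $t{:}A\to(!t{:}(t{:}A)\wedge KA)$; (A6) $(s{:}A\vee t{:}A)\to(s+t){:}A$; (A7) S4 axioms for $K$; (A8) $KA\to\Box K\Box A$; (A9) $\Box Et\to K\Box Et$. Rules: (R1) modus ponens; (R2) from $A$ infer $KA$; (R3) if $A$ is an instance of (A0)–(A9) and $c\in PConst$, infer $c{:}A$; (R4) from $KA\to(\neg\Box Et_1\vee\dots\vee\neg\Box Et_n)$ infer $KA\to(\neg Et_1\vee\dots\vee\neg Et_n)$. $\vdash A$ means $A$ is derivable. $\Gamma$ is inconsistent iff $\vdash(A_1\wedge\dots\wedge A_n)\to\bot$ for some $A_1,\dots,A_n\in\Gamma$; consistent otherwise. *)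

theory Defs
  imports Main "HOL-Library.Disjoint_Sets"
begin

section \<open>Language\<close>

text \<open>Proof variables, proof constants and propositional variables are all indexed by
  \<^typ>\<open>nat\<close>; distinct constructors keep the three sorts disjoint. The type variable
  \<open>'a\<close> is the type of agents.\<close>

datatype pol =
    PVar nat
  | PConst nat
  | Plus pol pol
  | Times pol pol
  | Bang pol

datatype 'a form =
    Atom nat
  | Conj "'a form" "'a form"
  | Neg "'a form"
  | Stit 'a "'a form"
  | Box "'a form"
  | Just pol "'a form"  \<comment> \<open>\<open>t:A\<close>\<close>
  | Know "'a form"
  | Ev pol  \<comment> \<open>\<open>Et\<close>\<close>

abbreviation Disj :: "'a form \<Rightarrow> 'a form \<Rightarrow> 'a form" where
  "Disj A B \<equiv> Neg (Conj (Neg A) (Neg B))"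

abbreviation Imp :: "'a form \<Rightarrow> 'a form \<Rightarrow> 'a form" where
  "Imp A B \<equiv> Neg (Conj A (Neg B))"

abbreviation Bot :: "'a form" where
  "Bot \<equiv> Conj (Atom 0) (Neg (Atom 0))"

abbreviation Dia :: "'a form \<Rightarrow> 'a form" where
  "Dia A \<equiv> Neg (Box (Neg A))"

text \<open>Finite conjunctions and disjunctions are bracketed to the right, and the conjunction or
  disjunction of a single formula is that formula. The clauses for the empty list never matter:
  below, only nonempty lists are used.\<close>

fun BigConj :: "'a form list \<Rightarrow> 'a form" where
  "BigConj [] = Neg Bot"
| "BigConj [A] = A"
| "BigConj (A # B # As) = Conj A (BigConj (B # As))"

fun BigDisj :: "'a form list \<Rightarrow> 'a form" where
  "BigDisj [] = Bot"
| "BigDisj [A] = A"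
| "BigDisj (A # B # As) = Disj A (BigDisj (B # As))"


section \<open>Models\<close>

text \<open>The moments are a subset of the type \<open>'w\<close>. Histories are sets of moments, so
  \<open>choice M m j\<close> is a set of sets of histories.\<close>

record ('a, 'w) jstit =
  moments :: "'w set"
  prec :: "('w \<times> 'w) set"
  choice :: "'w \<Rightarrow> 'a \<Rightarrow> 'w set set set"
  act :: "'w \<Rightarrow> 'w set \<Rightarrow> pol set"
  rel :: "('w \<times> 'w) set"
  rel_e :: "('w \<times> 'w) set"
  evid :: "'w \<Rightarrow> pol \<Rightarrow> 'a form set"
  val :: "nat \<Rightarrow> ('w \<times> 'w set) set"

definition sprec :: "('a, 'w) jstit \<Rightarrow> ('w \<times> 'w) set" where
  "sprec M = prec M - Id"

definition histories :: "('a, 'w) jstit \<Rightarrow> 'w set set" where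
  "histories M = {h \<in> Chains (prec M). \<forall>h' \<in> Chains (prec M). h \<subseteq> h' \<longrightarrow> h' = h}"

definition hist :: "('a, 'w) jstit \<Rightarrow> 'w \<Rightarrow> 'w set set" where
  "hist M m = {h \<in> histories M. m \<in> h}"

definition MH :: "('a, 'w) jstit \<Rightarrow> ('w \<times> 'w set) set" where
  "MH M = {(m, h). m \<in> moments M \<and> h \<in> hist M m}"

text \<open>The cell is unique, hence \<open>THE\<close> is meaningful, whenever \<open>choice M m j\<close> is a partition of
  \<open>hist M m\<close> and \<open>h \<in> hist M m\<close>.\<close>

definition cell :: "('a, 'w) jstit \<Rightarrow> 'w \<Rightarrow> 'a \<Rightarrow> 'w set \<Rightarrow> 'w set set" where
  "cell M m j h = (THE C. C \<in> choice M m j \<and> h \<in> C)"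

definition undivided :: "('a, 'w) jstit \<Rightarrow> 'w \<Rightarrow> 'w set \<Rightarrow> 'w set \<Rightarrow> bool" where
  "undivided M m h h' \<longleftrightarrow> (\<exists>m'. (m, m') \<in> sprec M \<and> m' \<in> h \<inter> h')"

locale jstit_model =
  fixes M :: "('a, 'w) jstit"
  assumes moments_nonempty: "moments M \<noteq> {}"
    and prec_order: "partial_order_on (moments M) (prec M)"
    and choice_partition: "m \<in> moments M \<Longrightarrow> partition_on (hist M m) (choice M m j)"
    and rel_preorder: "preorder_on (moments M) (rel M)"
    and rel_e_preorder: "preorder_on (moments M) (rel_e M)"
    and rel_subset_rel_e: "rel M \<subseteq> rel_e M"
    and val_subset: "val M p \<subseteq> MH M"
    and historical_connection:
      "\<lbrakk>m1 \<in> moments M; m2 \<in> moments M\<rbrakk> \<Longrightarrow> \<exists>m. (m, m1) \<in> prec M \<and> (m, m2) \<in> prec M"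
    and no_backward_branching:
      "\<lbrakk>(m1, m) \<in> prec M; (m2, m) \<in> prec M\<rbrakk> \<Longrightarrow> (m1, m2) \<in> prec M \<or> (m2, m1) \<in> prec M"
    and no_choice_between_undivided:
      "\<lbrakk>m \<in> moments M; h \<in> hist M m; h' \<in> hist M m; undivided M m h h'\<rbrakk>
        \<Longrightarrow> cell M m j h = cell M m j h'"
    and independence_of_agents:
      "\<lbrakk>m \<in> moments M; \<And>j. f j \<in> choice M m j\<rbrakk> \<Longrightarrow> (\<Inter>j. f j) \<noteq> {}"
    and evid_monotone: "(m, m') \<in> rel_e M \<Longrightarrow> evid M m t \<subseteq> evid M m' t"
    and evid_times:
      "\<lbrakk>m \<in> moments M; Imp A B \<in> evid M m s; A \<in> evid M m t\<rbrakk> \<Longrightarrow> B \<in> evid M m (Times s t)"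
    and evid_plus: "m \<in> moments M \<Longrightarrow> evid M m s \<union> evid M m t \<subseteq> evid M m (Plus s t)"
    and evid_bang: "\<lbrakk>m \<in> moments M; A \<in> evid M m t\<rbrakk> \<Longrightarrow> Just t A \<in> evid M m (Bang t)"
    and act_expansion:
      "\<lbrakk>(m', m) \<in> sprec M; h \<in> hist M m\<rbrakk> \<Longrightarrow> act M m' h \<subseteq> act M m h"
    and no_new_proofs_guaranteed:
      "m \<in> moments M \<Longrightarrow>
        (\<Inter>h \<in> hist M m. act M m h) \<subseteq>
        (\<Union>m' \<in> {m'. (m', m) \<in> sprec M}. \<Union>h \<in> hist M m. act M m' h)"
    and presenting_makes_histories_divide:
      "\<lbrakk>m \<in> moments M; h \<in> hist M m; h' \<in> hist M m; undivided M m h h'\<rbrakk>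
        \<Longrightarrow> act M m h = act M m h'"
    and future_always_matters: "prec M \<subseteq> rel M"
    and presented_proofs_epistemically_transparent:
      "(m, m') \<in> rel_e M \<Longrightarrow>
        (\<Inter>h \<in> hist M m. act M m h) \<subseteq> (\<Inter>h' \<in> hist M m'. act M m' h')"

primrec holds :: "('a, 'w) jstit \<Rightarrow> 'w \<Rightarrow> 'w set \<Rightarrow> 'a form \<Rightarrow> bool" where
  "holds M m h (Atom p) \<longleftrightarrow> (m, h) \<in> val M p"
| "holds M m h (Conj A B) \<longleftrightarrow> holds M m h A \<and> holds M m h B"
| "holds M m h (Neg A) \<longleftrightarrow> \<not> holds M m h A"
| "holds M m h (Stit j A) \<longleftrightarrow> (\<forall>h' \<in> cell M m j h. holds M m h' A)"
| "holds M m h (Box A) \<longleftrightarrow> (\<forall>h' \<in> hist M m. holds M m h' A)"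
| "holds M m h (Just t A) \<longleftrightarrow>
    A \<in> evid M m t \<and> (\<forall>m'. (m, m') \<in> rel_e M \<longrightarrow> (\<forall>h' \<in> hist M m'. holds M m' h' A))"
| "holds M m h (Know A) \<longleftrightarrow>
    (\<forall>m'. (m, m') \<in> rel M \<longrightarrow> (\<forall>h' \<in> hist M m'. holds M m' h' A))"
| "holds M m h (Ev t) \<longleftrightarrow> t \<in> act M m h"

definition satisfiable_in :: "('a, 'w) jstit \<Rightarrow> 'a form set \<Rightarrow> bool" where
  "satisfiable_in M \<Gamma> \<longleftrightarrow> (\<exists>(m, h) \<in> MH M. \<forall>A \<in> \<Gamma>. holds M m h A)"

definition unirelational :: "('a, 'w) jstit \<Rightarrow> bool" where
  "unirelational M \<longleftrightarrow> rel_e M \<subseteq> rel M"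


section \<open>The axiomatic system\<close>

text \<open>A propositional tautology is true under all truth assignments to its maximal subformulas
  that are neither conjunctions nor negations.\<close>

fun boolean_value :: "('a form \<Rightarrow> bool) \<Rightarrow> 'a form \<Rightarrow> bool" where
  "boolean_value v (Conj A B) \<longleftrightarrow> boolean_value v A \<and> boolean_value v B"
| "boolean_value v (Neg A) \<longleftrightarrow> \<not> boolean_value v A"
| "boolean_value v A \<longleftrightarrow> v A"

definition tautology :: "'a form \<Rightarrow> bool" where
  "tautology A \<longleftrightarrow> (\<forall>v. boolean_value v A)"

inductive S5_axiom :: "('a form \<Rightarrow> 'a form) \<Rightarrow> 'a form \<Rightarrow> bool" for N where
  "S5_axiom N (Imp (N (Imp A B)) (Imp (N A) (N B)))"
| "S5_axiom N (Imp (N A) A)"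
| "S5_axiom N (Imp (N A) (N (N A)))"
| "S5_axiom N (Imp (Neg (N (Neg A))) (N (Neg (N (Neg A)))))"

inductive S4_axiom :: "('a form \<Rightarrow> 'a form) \<Rightarrow> 'a form \<Rightarrow> bool" for N where
  "S4_axiom N (Imp (N (Imp A B)) (Imp (N A) (N B)))"
| "S4_axiom N (Imp (N A) A)"
| "S4_axiom N (Imp (N A) (N (N A)))"

inductive axiom :: "'a form \<Rightarrow> bool" where
  A0: "tautology A \<Longrightarrow> axiom A"
| A1_Box: "S5_axiom Box A \<Longrightarrow> axiom A"
| A1_Stit: "S5_axiom (Stit j) A \<Longrightarrow> axiom A"
| A2: "axiom (Imp (Box A) (Stit j A))"
| A3: "\<lbrakk>jAs \<noteq> []; distinct (map fst jAs)\<rbrakk> \<Longrightarrow>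
    axiom (Imp (BigConj (map (\<lambda>(j, A). Dia (Stit j A)) jAs))
               (Dia (BigConj (map (\<lambda>(j, A). Stit j A) jAs))))"
| A4: "axiom (Imp (Just s (Imp A B)) (Imp (Just t A) (Just (Times s t) B)))"
| A5: "axiom (Imp (Just t A) (Conj (Just (Bang t) (Just t A)) (Know A)))"
| A6: "axiom (Imp (Disj (Just s A) (Just t A)) (Just (Plus s t) A))"
| A7: "S4_axiom Know A \<Longrightarrow> axiom A"
| A8: "axiom (Imp (Know A) (Box (Know (Box A))))"
| A9: "axiom (Imp (Box (Ev t)) (Know (Box (Ev t))))"

inductive derivable :: "'a form \<Rightarrow> bool"  ("\<turnstile> _" [50] 50) where
  Ax: "axiom A \<Longrightarrow> \<turnstile> A"
| R1: "\<lbrakk>\<turnstile> A; \<turnstile> Imp A B\<rbrakk> \<Longrightarrow> \<turnstile> B"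
| R2: "\<turnstile> A \<Longrightarrow> \<turnstile> Know A"
| R3: "axiom A \<Longrightarrow> \<turnstile> Just (PConst c) A"
| R4: "\<lbrakk>ts \<noteq> []; \<turnstile> Imp (Know A) (BigDisj (map (\<lambda>t. Neg (Box (Ev t))) ts))\<rbrakk>
    \<Longrightarrow> \<turnstile> Imp (Know A) (BigDisj (map (\<lambda>t. Neg (Ev t)) ts))"

definition inconsistent :: "'a form set \<Rightarrow> bool" where
  "inconsistent \<Gamma> \<longleftrightarrow> (\<exists>As. As \<noteq> [] \<and> set As \<subseteq> \<Gamma> \<and> \<turnstile> Imp (BigConj As) Bot)"

abbreviation consistent :: "'a form set \<Rightarrow> bool" where
  "consistent \<Gamma> \<equiv> \<not> inconsistent \<Gamma>"

definition normal_model :: "('a, 'w) jstit \<Rightarrow> bool" where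
  "normal_model M \<longleftrightarrow>
    (\<forall>c. \<forall>m \<in> moments M. \<forall>A. axiom A \<longrightarrow> A \<in> evid M m (PConst c))"

end

theory Submission
  imports Defs "HOL-Library.Countable"
begin

text \<open>For completeness, a tree of moments is labelled with maximal consistent sets: every moment
  carries the members of one \<open>\<box>\<close>-class, and every history leaves a moment along one of these
  members. A history leaving a moment along \<open>\<Gamma>\<close> must settle the \<open>Et\<close> in \<open>\<Gamma>\<close> afterwards, which
  rule (R4) makes possible. But then further \<open>Es\<close> may become settled, and these must have been
  presented before. So the moments after a branching form a copy of the integers, with no first
  element, that all carry the class of a single set \<open>S\<close>, chosen by a second maximality argument
  such that \<open>\<box>Et \<in> S\<close> whenever \<open>Et \<in> S\<close>; the main line of this copy leaves every moment along
  \<open>S\<close>. The root of the tree is not subject to the truth lemma.\<close>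

section \<open>Histories\<close>

text \<open>One epistemic relation suffices: by (A5) a justified formula is known to be justified,
  so evidence persists along the relation that compares known formulas, and the same model serves
  (ii) and (iii). To refute a knowledge claim, any maximal consistent set may be needed, so each
  must represent some moment, and such sets have no natural common past. Historical connection
  forces one: the root. Having no predecessors, it may present nothing along all its histories. Yet
  on the way to a moment just above it, it has to present exactly what is settled there: no less,
  since the root is the only place where this can have been presented, and no more, since presented
  proofs must be settled afterwards. These labels are not maximal consistent, hence no truth lemma
  at the root. This is harmless: the root knows nothing and every other moment knows the theorems,
  so the root is not epistemically accessible from the others. The type of moments only needs room
  for all sets of numbers: with finitely many agents formulas are countable, and a path is a finite
  sequence of pairs of formula sets and integers.\<close>

lemma maximal_Chains_extension:
  assumes "C \<in> Chains r"
  obtains h where "h \<in> Chains r" "C \<subseteq> h" "\<And>h'. \<lbrakk>h' \<in> Chains r; h \<subseteq> h'\<rbrakk> \<Longrightarrow> h' = h"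
proof -
  let ?A = "{h \<in> Chains r. C \<subseteq> h}"
  have "\<exists>h\<in>?A. \<forall>h'\<in>?A. h \<subseteq> h' \<longrightarrow> h' = h"
  proof (rule subset_Zorn_nonempty)
    show "?A \<noteq> {}" using assms by blast
    fix \<C> assume ne: "\<C> \<noteq> {}" and ch: "subset.chain ?A \<C>"
    have "\<Union>\<C> \<in> Chains r"
      unfolding Chains_def
    proof (intro CollectI ballI)
      fix a b assume "a \<in> \<Union>\<C>" "b \<in> \<Union>\<C>"
      then obtain X Y where "X \<in> \<C>" "a \<in> X" "Y \<in> \<C>" "b \<in> Y" by blast
      moreover have "X \<subseteq> Y \<or> Y \<subseteq> X" "\<C> \<subseteq> ?A"
        using ch calculation by (auto simp: subset_chain_def)
      ultimately show "(a, b) \<in> r \<or> (b, a) \<in> r" unfolding Chains_def by blast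
    qed
    moreover have "\<C> \<subseteq> ?A" using ch by (simp add: subset_chain_def)
    ultimately show "\<Union>\<C> \<in> ?A" using ne by blast
  qed
  then show thesis using that by (metis (no_types, lifting) mem_Collect_eq order_trans)
qed

lemma histories_maximal:
  "\<lbrakk>h \<in> histories M; h' \<in> Chains (prec M); h \<subseteq> h'\<rbrakk> \<Longrightarrow> h' = h"
  by (auto simp: histories_def)

lemma histories_linear:
  "\<lbrakk>h \<in> histories M; x \<in> h; y \<in> h\<rbrakk> \<Longrightarrow> (x, y) \<in> prec M \<or> (y, x) \<in> prec M"
  by (auto simp: histories_def Chains_def)

context jstit_model
begin

lemma prec_moments: "(m, m') \<in> prec M \<Longrightarrow> m \<in> moments M \<and> m' \<in> moments M"
  using prec_order by (auto simp: partial_order_on_def preorder_on_def)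

lemma prec_refl: "m \<in> moments M \<Longrightarrow> (m, m) \<in> prec M"
  using prec_order by (auto simp: partial_order_on_def preorder_on_def refl_on_def)

lemma prec_trans: "\<lbrakk>(x, y) \<in> prec M; (y, z) \<in> prec M\<rbrakk> \<Longrightarrow> (x, z) \<in> prec M"
  using prec_order by (auto simp: partial_order_on_def preorder_on_def dest: transD)

lemma history_moments: "\<lbrakk>h \<in> histories M; x \<in> h\<rbrakk> \<Longrightarrow> x \<in> moments M"
  using histories_linear[of h M x x] prec_moments by blast

text \<open>Members of \<open>h\<close> below \<open>x\<close> are comparable with \<open>y\<close>
  since there is no backward branching, those above \<open>x\<close> by transitivity; maximality of
  \<open>h\<close> does the rest.\<close>

lemma history_downward_closed:
  assumes "h \<in> histories M" "x \<in> h" "(y, x) \<in> prec M"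
  shows "y \<in> h"
proof -
  have "(y, z) \<in> prec M \<or> (z, y) \<in> prec M" if "z \<in> h" for z
    using histories_linear[OF assms(1,2) that] assms(3) no_backward_branching prec_trans by blast
  moreover have "(y, y) \<in> prec M" using assms(3) prec_moments prec_refl by blast
  ultimately have "insert y h \<in> Chains (prec M)"
    using histories_linear[OF assms(1)] unfolding Chains_def by blast
  then show ?thesis using histories_maximal[OF assms(1)] by blast
qed

text \<open>If \<open>h\<close> ends at \<open>m\<close>, it consists of predecessors of
  \<open>m\<close>, and these lie on every history through \<open>m\<close>. This is the degenerate
  case in the soundness of (R4).\<close>

lemma hist_unique_if_last:
  assumes h: "h \<in> hist M m" and last: "\<And>x. (m, x) \<in> sprec M \<Longrightarrow> x \<notin> h"
    and h': "h' \<in> hist M m"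
  shows "h' = h"
proof -
  have H: "h \<in> histories M" "m \<in> h" "h' \<in> histories M" "m \<in> h'"
    using h h' by (auto simp: hist_def)
  have m: "(m, m) \<in> prec M" using H history_moments prec_refl by blast
  have below: "(x, m) \<in> prec M" if "x \<in> h" for x
    using histories_linear[OF H(1) that H(2)] last[of x] that m by (auto simp: sprec_def)
  have "h \<subseteq> h'" using below history_downward_closed[OF H(3,4)] by blast
  then show ?thesis using histories_maximal[OF H(1)] H(3) by (auto simp: histories_def)
qed

lemma hist_later:
  assumes "(m, m') \<in> prec M" "h \<in> hist M m'"
  shows "h \<in> hist M m"
  using assms history_downward_closed[of h m' m] by (auto simp: hist_def)

lemma cell_eq:
  assumes m: "m \<in> moments M" and C: "C \<in> choice M m j" "h \<in> C"
  shows "cell M m j h = C"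
  unfolding cell_def
proof (rule the_equality)
  show "D = C" if "D \<in> choice M m j \<and> h \<in> D" for D
    using partition_onD2[OF choice_partition[OF m, of j]] C that
    unfolding disjoint_def by blast
qed (use C in blast)

lemma cell_choice:
  assumes m: "m \<in> moments M" and h: "h \<in> hist M m"
  shows "cell M m j h \<in> choice M m j" "h \<in> cell M m j h" "cell M m j h \<subseteq> hist M m"
proof -
  obtain C where C: "C \<in> choice M m j" "h \<in> C"
    using choice_partition[OF m, of j] h by (auto simp: partition_on_def)
  then have "cell M m j h = C" using cell_eq m by blast
  then show "cell M m j h \<in> choice M m j" "h \<in> cell M m j h" "cell M m j h \<subseteq> hist M m"
    using C choice_partition[OF m, of j] by (auto simp: partition_on_def)
qed

lemma cell_same:
  "\<lbrakk>m \<in> moments M; h \<in> hist M m; h' \<in> cell M m j h\<rbrakk> \<Longrightarrow> cell M m j h' = cell M m j h"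
  by (simp add: cell_eq cell_choice(1))

end

section \<open>Soundness\<close>

lemma holds_BigConj: "As \<noteq> [] \<Longrightarrow> holds M m h (BigConj As) \<longleftrightarrow> (\<forall>A\<in>set As. holds M m h A)"
  by (induction As rule: BigConj.induct) auto

lemma holds_BigDisj: "As \<noteq> [] \<Longrightarrow> holds M m h (BigDisj As) \<longleftrightarrow> (\<exists>A\<in>set As. holds M m h A)"
  by (induction As rule: BigDisj.induct) auto

lemma holds_boolean_value: "boolean_value (holds M m h) A = holds M m h A"
  by (induction A) auto

context jstit_model
begin

lemma rel_refl: "m \<in> moments M \<Longrightarrow> (m, m) \<in> rel M"
  using rel_preorder by (auto simp: preorder_on_def refl_on_def)

lemma rel_trans: "\<lbrakk>(x, y) \<in> rel M; (y, z) \<in> rel M\<rbrakk> \<Longrightarrow> (x, z) \<in> rel M"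
  using rel_preorder by (auto simp: preorder_on_def dest: transD)

lemma rel_moments: "(m, m') \<in> rel M \<Longrightarrow> m' \<in> moments M"
  using rel_preorder by (auto simp: preorder_on_def)

lemma rel_e_trans: "\<lbrakk>(x, y) \<in> rel_e M; (y, z) \<in> rel_e M\<rbrakk> \<Longrightarrow> (x, z) \<in> rel_e M"
  using rel_e_preorder by (auto simp: preorder_on_def dest: transD)

lemma rel_e_moments: "(m, m') \<in> rel_e M \<Longrightarrow> m' \<in> moments M"
  using rel_e_preorder by (auto simp: preorder_on_def)

text \<open>The independence constraint wants a cell from every agent. An agent in the list takes
  the cell that witnesses its formula, which is unique by distinctness; any other agent takes an
  arbitrary cell.\<close>

lemma independence_valid:
  assumes m: "m \<in> moments M" and h: "h \<in> hist M m" and ne: "jAs \<noteq> []"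
    and dist: "distinct (map fst jAs)"
    and dia: "\<forall>(j, A) \<in> set jAs. \<exists>h'\<in>hist M m. \<forall>h''\<in>cell M m j h'. holds M m h'' A"
  shows "\<exists>h'\<in>hist M m. \<forall>(j, A) \<in> set jAs. \<forall>h''\<in>cell M m j h'. holds M m h'' A"
proof -
  define g where "g j = (SOME h'. h' \<in> hist M m \<and>
    (\<forall>A. (j, A) \<in> set jAs \<longrightarrow> (\<forall>h''\<in>cell M m j h'. holds M m h'' A)))" for j
  have g: "g j \<in> hist M m \<and>
    (\<forall>A. (j, A) \<in> set jAs \<longrightarrow> (\<forall>h''\<in>cell M m j (g j). holds M m h'' A))" for j
    unfolding g_def
  proof (rule someI_ex, cases "j \<in> fst ` set jAs")
    case True
    then obtain A where A: "(j, A) \<in> set jAs" by auto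
    then have "B = A" if "(j, B) \<in> set jAs" for B
      using dist that by (metis eq_key_imp_eq_value)
    then show "\<exists>h'. h' \<in> hist M m \<and>
      (\<forall>A. (j, A) \<in> set jAs \<longrightarrow> (\<forall>h''\<in>cell M m j h'. holds M m h'' A))"
      using dia A by fast
  next
    case False
    then show "\<exists>h'. h' \<in> hist M m \<and>
      (\<forall>A. (j, A) \<in> set jAs \<longrightarrow> (\<forall>h''\<in>cell M m j h'. holds M m h'' A))"
      using h by force
  qed
  have "(\<Inter>j. cell M m j (g j)) \<noteq> {}"
    using independence_of_agents[OF m, of "\<lambda>j. cell M m j (g j)"] cell_choice(1)[OF m] g by blast
  then obtain h' where h': "h' \<in> cell M m j (g j)" for j by blast
  have "cell M m j h' = cell M m j (g j)" for j
    using cell_same[OF m] g h' by blast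
  moreover have "h' \<in> hist M m" using cell_choice(3)[OF m] g h' by blast
  ultimately show ?thesis using g by (intro bexI[of _ h']) auto
qed

lemma axiom_valid:
  assumes "axiom A" "m \<in> moments M" "h \<in> hist M m"
  shows "holds M m h A"
  using assms
proof (induction arbitrary: m h rule: axiom.induct)
  case (A0 A)
  then show ?case by (metis holds_boolean_value tautology_def)
next
  case (A1_Box A)
  from A1_Box(1) show ?case by cases (use A1_Box in auto)
next
  case (A1_Stit j A)
  \<comment> \<open>The S5 schemes follow from two facts alone: \<open>h\<close> lies in its cell
    \<open>C\<close>, and \<open>C\<close> is the cell of each of its members.\<close>
  define C where "C = cell M m j h"
  have "h \<in> C" using cell_choice(2)[OF A1_Stit(2,3)] by (simp only: C_def)
  moreover have "cell M m j h' = C" if "h' \<in> C" for h'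
    using cell_same[OF A1_Stit(2,3)] that unfolding C_def by blast
  moreover from A1_Stit(1) have ?case
    if "h \<in> C" "\<And>h'. h' \<in> C \<Longrightarrow> cell M m j h' = C"
    by cases (use that in \<open>auto simp flip: C_def\<close>)
  ultimately show ?case by blast
next
  case (A2 A j)
  then show ?case using cell_choice(3)[OF A2, of j] by auto
next
  case (A3 jAs)
  show ?case
    using independence_valid[OF A3(3,4,1,2)] A3(1)
    by (simp add: holds_BigConj case_prod_beta) blast
next
  case (A4 s A B t)
  then show ?case using evid_times by auto
next
  case (A5 t A)
  then show ?case using evid_bang evid_monotone rel_e_trans rel_subset_rel_e
    by simp blast
next
  case (A6 s A t)
  then show ?case using evid_plus[OF A6(1), of s t] by auto
next
  case (A7 A)
  from A7(1) show ?case
  proof cases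
    case 2
    then show ?thesis using rel_refl[OF A7(2)] A7(3) by auto
  next
    case 3
    then show ?thesis using rel_trans by simp blast
  qed auto
next
  case (A8 A)
  then show ?case by auto
next
  case (A9 t)
  have "t \<in> act M m' h'" if "\<forall>h\<in>hist M m. t \<in> act M m h" "(m, m') \<in> rel M" "h' \<in> hist M m'" for m' h'
  proof -
    have "(m, m') \<in> rel_e M" using that(2) rel_subset_rel_e by blast
    from presented_proofs_epistemically_transparent[OF this] that(1,3) show ?thesis by blast
  qed
  then show ?case by auto
qed

text \<open>Soundness of (R4). If \<open>h\<close> continues to some \<open>m'\<close>, the
  knowledge of \<open>A\<close> persists there, so some \<open>t\<close> in \<open>T\<close> is
  missing at \<open>m'\<close> along some \<open>h'\<close>. Since \<open>h'\<close> and
  \<open>h\<close> are undivided at \<open>m\<close>, they present the same proofs at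
  \<open>m\<close>, and by expansion \<open>t\<close> is missing there too.\<close>

lemma presented_eventually_settled:
  assumes m: "m \<in> moments M" and h: "h \<in> hist M m" and K: "holds M m h (Know A)"
    and valid: "\<And>m h. \<lbrakk>m \<in> moments M; h \<in> hist M m; holds M m h (Know A)\<rbrakk>
        \<Longrightarrow> \<exists>t\<in>T. \<not> holds M m h (Box (Ev t))"
  shows "\<exists>t\<in>T. \<not> holds M m h (Ev t)"
proof (cases "\<exists>m'. (m, m') \<in> sprec M \<and> m' \<in> h")
  case True
  then obtain m' where m': "(m, m') \<in> sprec M" "m' \<in> h" by blast
  then have p: "(m, m') \<in> prec M" by (auto simp: sprec_def)
  have "h \<in> hist M m'" using h m' by (auto simp: hist_def)
  moreover have "holds M m' h (Know A)"
    using K p future_always_matters rel_trans by auto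
  ultimately obtain t h' where t: "t \<in> T" "h' \<in> hist M m'" "t \<notin> act M m' h'"
    using valid[of m' h] prec_moments[OF p] by auto
  have "h' \<in> hist M m" using hist_later[OF p] t by blast
  moreover have "undivided M m h h'" using m' t by (auto simp: undivided_def hist_def)
  ultimately have "act M m h = act M m h'"
    using presenting_makes_histories_divide m h by blast
  then show ?thesis using t act_expansion[OF m'(1)] by auto
next
  case False
  then have "hist M m = {h}" using hist_unique_if_last[OF h] h by blast
  then show ?thesis using valid[OF m h K] by auto
qed

lemma derivable_valid:
  assumes "\<turnstile> A" and normal: "normal_model M" and "m \<in> moments M" "h \<in> hist M m"
  shows "holds M m h A"
  using assms(1,3,4)
proof (induction arbitrary: m h rule: derivable.induct)
  case (Ax A)
  then show ?case using axiom_valid by blast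
next
  case (R1 A B)
  then show ?case by simp
next
  case (R2 A)
  then show ?case using rel_moments by auto
next
  case (R3 A c)
  then show ?case using normal axiom_valid rel_e_moments by (auto simp: normal_model_def)
next
  case (R4 ts A)
  have "\<exists>t\<in>set ts. \<not> holds M m h (Box (Ev t))"
    if "m \<in> moments M" "h \<in> hist M m" "holds M m h (Know A)" for m h
    using R4(1) R4.IH[OF that(1,2)] that(3) by (auto simp: holds_BigDisj simp del: holds.simps(7))
  then have "\<exists>t\<in>set ts. \<not> holds M m h (Ev t)" if "holds M m h (Know A)"
    using presented_eventually_settled[OF R4.prems that] by blast
  then show ?case using R4(1) by (auto simp: holds_BigDisj simp del: holds.simps(7))
qed

lemma satisfiable_consistent:
  assumes "normal_model M" "satisfiable_in M \<Gamma>"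
  shows "consistent \<Gamma>"
proof
  assume "inconsistent \<Gamma>"
  then obtain As where As: "As \<noteq> []" "set As \<subseteq> \<Gamma>" "\<turnstile> Imp (BigConj As) Bot"
    by (auto simp: inconsistent_def)
  obtain m h where mh: "m \<in> moments M" "h \<in> hist M m" "\<forall>A\<in>\<Gamma>. holds M m h A"
    using assms(2) by (auto simp: satisfiable_in_def MH_def)
  then show False
    using derivable_valid[OF As(3) assms(1) mh(1,2)] As by (auto simp: holds_BigConj)
qed

end

section \<open>Derivability from assumptions\<close>

text \<open>The rules apply to theorems only and assumptions enter through nested implications, so
  the deduction property is unrestricted. In contrast to \<open>inconsistent\<close>, the list may
  be empty.\<close>

definition der :: "'a form set \<Rightarrow> 'a form \<Rightarrow> bool"  (infix "\<tturnstile>" 50) where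
  "\<Gamma> \<tturnstile> A \<longleftrightarrow> (\<exists>As. set As \<subseteq> \<Gamma> \<and> \<turnstile> foldr Imp As A)"

abbreviation con :: "'a form set \<Rightarrow> bool" where
  "con \<Gamma> \<equiv> \<not> \<Gamma> \<tturnstile> Bot"

lemma boolean_value_foldr_Imp:
  "boolean_value v (foldr Imp As B) \<longleftrightarrow> (\<forall>A\<in>set As. boolean_value v A) \<longrightarrow> boolean_value v B"
  by (induction As) auto

lemma boolean_value_BigConj:
  "boolean_value v (BigConj As) \<longleftrightarrow> (\<forall>A\<in>set As. boolean_value v A)"
  by (induction As rule: BigConj.induct) auto

lemma boolean_value_BigDisj:
  "boolean_value v (BigDisj As) \<longleftrightarrow> (\<exists>A\<in>set As. boolean_value v A)"
  by (induction As rule: BigDisj.induct) auto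

lemma derivable_detach: "\<lbrakk>\<turnstile> foldr Imp As B; \<forall>A\<in>set As. \<turnstile> A\<rbrakk> \<Longrightarrow> \<turnstile> B"
proof (induction As)
  case (Cons A As)
  then have "\<turnstile> foldr Imp As B" using R1[of A "foldr Imp As B"] by simp
  then show ?case using Cons by simp
qed simp

text \<open>Replaces Hilbert-style propositional derivations by truth-value arguments: the nested
  implication from the premises to the conclusion is itself a tautology.\<close>

lemma derivable_consequence:
  assumes "\<forall>A\<in>set As. \<turnstile> A" "\<And>v. \<forall>A\<in>set As. boolean_value v A \<Longrightarrow> boolean_value v B"
  shows "\<turnstile> B"
proof (rule derivable_detach)
  show "\<turnstile> foldr Imp As B"
    using assms(2) by (intro Ax A0) (simp add: tautology_def boolean_value_foldr_Imp)
qed (fact assms(1))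

lemma der_mono: "\<lbrakk>\<Gamma> \<tturnstile> A; \<Gamma> \<subseteq> \<Delta>\<rbrakk> \<Longrightarrow> \<Delta> \<tturnstile> A"
  unfolding der_def by blast

lemma der_theorem: "\<turnstile> A \<Longrightarrow> \<Gamma> \<tturnstile> A"
  unfolding der_def by (intro exI[of _ "[]"]) simp

lemma der_assumption: "A \<in> \<Gamma> \<Longrightarrow> \<Gamma> \<tturnstile> A"
  unfolding der_def
  by (intro exI[of _ "[A]"] conjI derivable_consequence[of "[]"]) auto

lemma der_mp:
  assumes "\<Gamma> \<tturnstile> A" "\<Gamma> \<tturnstile> Imp A B"
  shows "\<Gamma> \<tturnstile> B"
proof -
  obtain As Bs where "set As \<subseteq> \<Gamma>" "\<turnstile> foldr Imp As A" "set Bs \<subseteq> \<Gamma>" "\<turnstile> foldr Imp Bs (Imp A B)"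
    using assms unfolding der_def by blast
  moreover from this have "\<turnstile> foldr Imp (As @ Bs) B"
    by (intro derivable_consequence[of "[foldr Imp As A, foldr Imp Bs (Imp A B)]"])
      (auto simp del: foldr_append simp: boolean_value_foldr_Imp)
  ultimately show ?thesis unfolding der_def by (intro exI[of _ "As @ Bs"]) auto
qed

lemma der_consequence:
  assumes "\<forall>A\<in>set As. \<Gamma> \<tturnstile> A" "\<And>v. \<forall>A\<in>set As. boolean_value v A \<Longrightarrow> boolean_value v B"
  shows "\<Gamma> \<tturnstile> B"
proof -
  have "\<turnstile> foldr Imp As B"
    using assms(2) by (intro derivable_consequence[of "[]"]) (simp_all add: boolean_value_foldr_Imp)
  then have "\<Gamma> \<tturnstile> foldr Imp As B" by (rule der_theorem)
  then show ?thesis using assms(1)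
  proof (induction As)
    case (Cons A As)
    then have "\<Gamma> \<tturnstile> foldr Imp As B" using der_mp[of \<Gamma> A "foldr Imp As B"] by simp
    then show ?case using Cons by simp
  qed simp
qed

lemma der_deduction:
  assumes "insert A \<Gamma> \<tturnstile> B"
  shows "\<Gamma> \<tturnstile> Imp A B"
proof -
  obtain As where As: "set As \<subseteq> insert A \<Gamma>" "\<turnstile> foldr Imp As B"
    using assms unfolding der_def by blast
  have "\<turnstile> foldr Imp (filter (\<lambda>C. C \<noteq> A) As) (Imp A B)"
    using As(2) by (intro derivable_consequence[of "[foldr Imp As B]"])
      (auto simp: boolean_value_foldr_Imp)
  then show ?thesis
    using As(1) unfolding der_def by (intro exI[of _ "filter (\<lambda>C. C \<noteq> A) As"]) auto
qed

lemma der_finite: "\<Gamma> \<tturnstile> A \<Longrightarrow> \<exists>As. set As \<subseteq> \<Gamma> \<and> set As \<tturnstile> A"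
  unfolding der_def by blast

lemma con_insert_Neg:
  assumes "\<not> \<Gamma> \<tturnstile> A"
  shows "con (insert (Neg A) \<Gamma>)"
proof
  assume "insert (Neg A) \<Gamma> \<tturnstile> Bot"
  from der_deduction[OF this] have "\<Gamma> \<tturnstile> A"
    by (intro der_consequence[of "[Imp (Neg A) Bot]"]) auto
  then show False using assms by simp
qed

text \<open>Erasing all modalities and falsifying every \<open>Et\<close> makes all theorems true.\<close>

primrec erasure :: "'a form \<Rightarrow> bool" where
  "erasure (Atom p) \<longleftrightarrow> True"
| "erasure (Conj A B) \<longleftrightarrow> erasure A \<and> erasure B"
| "erasure (Neg A) \<longleftrightarrow> \<not> erasure A"
| "erasure (Stit j A) \<longleftrightarrow> erasure A"
| "erasure (Box A) \<longleftrightarrow> erasure A"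
| "erasure (Just t A) \<longleftrightarrow> erasure A"
| "erasure (Know A) \<longleftrightarrow> erasure A"
| "erasure (Ev t) \<longleftrightarrow> False"

lemma erasure_boolean_value: "boolean_value erasure A = erasure A"
  by (induction A) auto

lemma erasure_BigConj: "erasure (BigConj As) \<longleftrightarrow> (\<forall>A\<in>set As. erasure A)"
  by (induction As rule: BigConj.induct) auto

lemma erasure_BigDisj: "erasure (BigDisj As) \<longleftrightarrow> (\<exists>A\<in>set As. erasure A)"
  by (induction As rule: BigDisj.induct) auto

lemma axiom_erasure: "axiom A \<Longrightarrow> erasure A"
proof (induction rule: axiom.induct)
  case (A0 A)
  then show ?case by (metis erasure_boolean_value tautology_def)
next
  case (A3 jAs)
  then show ?case by (force simp: erasure_BigConj)
qed (auto elim: S5_axiom.cases S4_axiom.cases)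

lemma derivable_erasure: "\<turnstile> A \<Longrightarrow> erasure A"
proof (induction rule: derivable.induct)
  case (R4 ts A)
  then show ?case by (auto simp: erasure_BigDisj neq_Nil_conv)
qed (auto simp: axiom_erasure)

lemma consistent_con:
  assumes "consistent \<Gamma>"
  shows "con \<Gamma>"
proof
  assume "\<Gamma> \<tturnstile> Bot"
  then obtain As where As: "set As \<subseteq> \<Gamma>" "\<turnstile> foldr Imp As Bot" unfolding der_def by blast
  \<comment> \<open>With an empty list \<open>Bot\<close> would be a theorem, which erasure refutes;
    \<open>inconsistent\<close> asks for a nonempty list.\<close>
  have "As \<noteq> []" using derivable_erasure[OF As(2)] by auto
  moreover have "\<turnstile> Imp (BigConj As) Bot"
    using As(2) by (intro derivable_consequence[of "[foldr Imp As Bot]"])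
      (auto simp: boolean_value_foldr_Imp boolean_value_BigConj)
  ultimately show False using assms As(1) by (auto simp: inconsistent_def)
qed

text \<open>Rests on erasure making \<open>Ev t\<close> false. It yields, for every
  \<open>t\<close>, a class in which \<open>t\<close> is not settled, so that the root presents
  nothing along all its histories.\<close>

lemma con_Neg_Ev: "con {Neg (Ev t) :: 'a form}"
proof
  assume "{Neg (Ev t) :: 'a form} \<tturnstile> Bot"
  from der_deduction[OF this] have "\<turnstile> Imp (Neg (Ev t)) (Bot :: 'a form)"
    by (auto simp: der_def)
  from derivable_erasure[OF this] show False by simp
qed

section \<open>Maximal consistent sets\<close>

text \<open>Maximality is relative to \<open>P\<close>: all formulas give Lindenbaum's lemma, and
  the formulas \<open>Box (Ev t)\<close> give the saturated successors.\<close>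

lemma maximal_con_extension:
  assumes "con \<Gamma>"
  shows "\<exists>\<Delta>. \<Gamma> \<subseteq> \<Delta> \<and> \<Delta> \<subseteq> \<Gamma> \<union> P \<and> con \<Delta> \<and> (\<forall>A\<in>P. con (insert A \<Delta>) \<longrightarrow> A \<in> \<Delta>)"
proof -
  let ?A = "{\<Delta>. \<Gamma> \<subseteq> \<Delta> \<and> \<Delta> \<subseteq> \<Gamma> \<union> P \<and> con \<Delta>}"
  have "\<exists>\<Delta>\<in>?A. \<forall>X\<in>?A. \<Delta> \<subseteq> X \<longrightarrow> X = \<Delta>"
  proof (rule subset_Zorn_nonempty)
    show "?A \<noteq> {}" using assms by blast
    fix \<C> assume ne: "\<C> \<noteq> {}" and ch: "subset.chain ?A \<C>"
    have sub: "\<C> \<subseteq> ?A" using ch by (simp add: subset_chain_def)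
    have "con (\<Union>\<C>)"
    proof
      assume "\<Union>\<C> \<tturnstile> Bot"
      then obtain As where As: "set As \<subseteq> \<Union>\<C>" "set As \<tturnstile> Bot" using der_finite by blast
      obtain X where "X \<in> \<C>" "set As \<subseteq> X"
        using finite_subset_Union_chain[OF finite_set As(1) ne ch] by blast
      then show False using As(2) sub der_mono by blast
    qed
    then show "\<Union>\<C> \<in> ?A" using ne sub by blast
  qed
  then obtain \<Delta> where \<Delta>: "\<Delta> \<in> ?A" "\<forall>X\<in>?A. \<Delta> \<subseteq> X \<longrightarrow> X = \<Delta>" by blast
  have "A \<in> \<Delta>" if "A \<in> P" "con (insert A \<Delta>)" for A
  proof -
    have "insert A \<Delta> \<in> ?A" using \<Delta>(1) that by blast
    then show ?thesis using \<Delta>(2) by blast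
  qed
  then show ?thesis using \<Delta>(1) by (intro exI[of _ \<Delta>]) simp
qed

definition mcs :: "'a form set \<Rightarrow> bool" where
  "mcs \<Gamma> \<longleftrightarrow> con \<Gamma> \<and> (\<forall>A. A \<in> \<Gamma> \<or> Neg A \<in> \<Gamma>)"

lemma lindenbaum:
  assumes "con \<Gamma>"
  obtains \<Delta> where "\<Gamma> \<subseteq> \<Delta>" "mcs \<Delta>"
proof -
  obtain \<Delta> where \<Delta>: "\<Gamma> \<subseteq> \<Delta>" "con \<Delta>" "\<forall>A. con (insert A \<Delta>) \<longrightarrow> A \<in> \<Delta>"
    using maximal_con_extension[OF assms, of UNIV] by auto
  have "A \<in> \<Delta> \<or> Neg A \<in> \<Delta>" for A
  proof (cases "\<Delta> \<tturnstile> A")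
    case True
    have "con (insert A \<Delta>)"
    proof
      assume "insert A \<Delta> \<tturnstile> Bot"
      then have "\<Delta> \<tturnstile> Imp A Bot" by (rule der_deduction)
      with True have "\<Delta> \<tturnstile> Bot" by (rule der_mp)
      then show False using \<Delta>(2) by blast
    qed
    then show ?thesis using \<Delta>(3) by blast
  next
    case False
    then show ?thesis using \<Delta>(3) con_insert_Neg by blast
  qed
  then show thesis using \<Delta> that by (auto simp: mcs_def)
qed

lemma mcs_der:
  assumes "mcs \<Gamma>" "\<Gamma> \<tturnstile> A"
  shows "A \<in> \<Gamma>"
proof (rule ccontr)
  assume "A \<notin> \<Gamma>"
  then have "\<Gamma> \<tturnstile> Neg A" using assms(1) der_assumption by (auto simp: mcs_def)
  then have "\<Gamma> \<tturnstile> Bot" using assms(2) by (intro der_consequence[of "[A, Neg A]"]) auto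
  then show False using assms(1) by (simp add: mcs_def)
qed

lemma mcs_con: "mcs \<Gamma> \<Longrightarrow> con \<Gamma>"
  by (simp add: mcs_def)

lemma mcs_theorem: "\<lbrakk>mcs \<Gamma>; \<turnstile> A\<rbrakk> \<Longrightarrow> A \<in> \<Gamma>"
  using mcs_der der_theorem by blast

lemma mcs_Neg: "mcs \<Gamma> \<Longrightarrow> Neg A \<in> \<Gamma> \<longleftrightarrow> A \<notin> \<Gamma>"
proof
  assume *: "mcs \<Gamma>" "Neg A \<in> \<Gamma>"
  show "A \<notin> \<Gamma>"
  proof
    assume "A \<in> \<Gamma>"
    then have "\<Gamma> \<tturnstile> Bot"
      using * by (intro der_consequence[of "[A, Neg A]"]) (auto intro: der_assumption)
    then show False using * by (simp add: mcs_def)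
  qed
qed (auto simp: mcs_def)

lemma mcs_Conj:
  assumes "mcs \<Gamma>"
  shows "Conj A B \<in> \<Gamma> \<longleftrightarrow> A \<in> \<Gamma> \<and> B \<in> \<Gamma>"
proof
  assume "Conj A B \<in> \<Gamma>"
  then have "\<Gamma> \<tturnstile> Conj A B" by (rule der_assumption)
  then have "\<Gamma> \<tturnstile> A" "\<Gamma> \<tturnstile> B" by (auto intro: der_consequence[of "[Conj A B]"])
  then show "A \<in> \<Gamma> \<and> B \<in> \<Gamma>" using assms mcs_der by blast
next
  assume "A \<in> \<Gamma> \<and> B \<in> \<Gamma>"
  then have "\<Gamma> \<tturnstile> Conj A B"
    by (intro der_consequence[of "[A, B]"]) (auto intro: der_assumption)
  then show "Conj A B \<in> \<Gamma>" using assms mcs_der by blast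
qed

lemma mcs_BigConj: "mcs \<Gamma> \<Longrightarrow> BigConj As \<in> \<Gamma> \<longleftrightarrow> set As \<subseteq> \<Gamma>"
  by (induction As rule: BigConj.induct) (auto simp: mcs_Conj mcs_Neg)

lemma mcs_mp: "\<lbrakk>mcs \<Gamma>; \<turnstile> Imp A B; A \<in> \<Gamma>\<rbrakk> \<Longrightarrow> B \<in> \<Gamma>"
  using mcs_theorem[of \<Gamma> "Imp A B"] by (simp add: mcs_Neg mcs_Conj)

lemma mcs_axiom: "\<lbrakk>mcs \<Gamma>; axiom (Imp A B); A \<in> \<Gamma>\<rbrakk> \<Longrightarrow> B \<in> \<Gamma>"
  using mcs_mp Ax by blast

section \<open>Normal modal operators\<close>

definition normal_op :: "('a form \<Rightarrow> 'a form) \<Rightarrow> bool" where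
  "normal_op N \<longleftrightarrow> (\<forall>A B. \<turnstile> Imp (N (Imp A B)) (Imp (N A) (N B))) \<and> (\<forall>A. \<turnstile> A \<longrightarrow> \<turnstile> N A)"

definition S5_op :: "('a form \<Rightarrow> 'a form) \<Rightarrow> bool" where
  "S5_op N \<longleftrightarrow> normal_op N \<and> (\<forall>A. S5_axiom N A \<longrightarrow> \<turnstile> A)"

definition unbox :: "('a form \<Rightarrow> 'a form) \<Rightarrow> 'a form set \<Rightarrow> 'a form set" where
  "unbox N \<Gamma> = {A. N A \<in> \<Gamma>}"

lemma normal_op_Know: "normal_op Know"
  unfolding normal_op_def by (auto intro: R2 Ax A7 S4_axiom.intros)

text \<open>The system has necessitation for \<open>Know\<close> only. Applied to
  \<open>Know A\<close>, (A8) gives \<open>Box (Know (Box A))\<close>, and the reflexivity axioms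
  strip the two outer operators.\<close>

lemma S5_op_Box: "S5_op Box"
proof -
  have "\<turnstile> Box A" if "\<turnstile> A" for A :: "'a form"
  proof -
    have "\<turnstile> Box (Know (Box A))" using that by (meson A8 Ax R1 R2)
    then have "\<turnstile> Know (Box A)" by (meson A1_Box Ax R1 S5_axiom.intros(2))
    then show ?thesis by (meson A7 Ax R1 S4_axiom.intros(2))
  qed
  then show ?thesis unfolding S5_op_def normal_op_def
    by (auto intro: Ax A1_Box S5_axiom.intros)
qed

lemma S5_op_Stit: "S5_op (Stit j)"
proof -
  have "\<turnstile> Stit j A" if "\<turnstile> A" for A
    using that S5_op_Box A2 Ax R1 unfolding S5_op_def normal_op_def by meson
  then show ?thesis unfolding S5_op_def normal_op_def
    by (auto intro: Ax A1_Stit S5_axiom.intros)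
qed

lemma S5_op_normal: "S5_op N \<Longrightarrow> normal_op N"
  by (simp add: S5_op_def)

lemma normal_op_foldr_Imp:
  assumes "normal_op N"
  shows "\<turnstile> Imp (N (foldr Imp As B)) (foldr Imp (map N As) (N B))"
proof (induction As)
  case Nil
  then show ?case by (intro derivable_consequence[of "[]"]) auto
next
  case (Cons A As)
  have "\<turnstile> Imp (N (Imp A (foldr Imp As B))) (Imp (N A) (N (foldr Imp As B)))"
    using assms by (auto simp: normal_op_def)
  with Cons show ?case
    by (intro derivable_consequence[of
        "[Imp (N (foldr Imp As B)) (foldr Imp (map N As) (N B)),
          Imp (N (Imp A (foldr Imp As B))) (Imp (N A) (N (foldr Imp As B)))]"]) auto
qed

lemma der_normal_op:
  assumes "normal_op N" "unbox N \<Gamma> \<tturnstile> B"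
  shows "\<Gamma> \<tturnstile> N B"
proof -
  obtain As where As: "set As \<subseteq> unbox N \<Gamma>" "\<turnstile> foldr Imp As B"
    using assms(2) unfolding der_def by blast
  have "\<turnstile> N (foldr Imp As B)" using As(2) assms(1) by (simp add: normal_op_def)
  then have "\<turnstile> foldr Imp (map N As) (N B)" using normal_op_foldr_Imp[OF assms(1)] R1 by blast
  moreover have "set (map N As) \<subseteq> \<Gamma>" using As(1) by (auto simp: unbox_def)
  ultimately show ?thesis unfolding der_def by blast
qed

lemma normal_op_mono:
  assumes "normal_op N" "\<turnstile> Imp A B"
  shows "\<turnstile> Imp (N A) (N B)"
proof -
  have "\<turnstile> N (Imp A B)" "\<turnstile> Imp (N (Imp A B)) (Imp (N A) (N B))"
    using assms by (auto simp: normal_op_def)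
  then show ?thesis using R1 by blast
qed

lemma mcs_witness:
  assumes "normal_op N" "mcs \<Gamma>" "N B \<notin> \<Gamma>"
  obtains \<Delta> where "mcs \<Delta>" "unbox N \<Gamma> \<subseteq> \<Delta>" "B \<notin> \<Delta>"
proof -
  have "\<not> unbox N \<Gamma> \<tturnstile> B" using assms der_normal_op mcs_der by blast
  from lindenbaum[OF con_insert_Neg[OF this]]
  obtain \<Delta> where "insert (Neg B) (unbox N \<Gamma>) \<subseteq> \<Delta>" "mcs \<Delta>" .
  then show thesis using that[of \<Delta>] by (auto simp: mcs_Neg)
qed

lemma S5_T: "\<lbrakk>S5_op N; mcs \<Gamma>; N A \<in> \<Gamma>\<rbrakk> \<Longrightarrow> A \<in> \<Gamma>"
  using mcs_mp[of \<Gamma> "N A" A] S5_axiom.intros(2)[of N A] by (simp add: S5_op_def)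

text \<open>Canonical accessibility for an S5 operator is symmetric, so the inclusion is an
  equality. Equality of \<open>unbox N\<close> therefore serves as the equivalence of maximal
  consistent sets throughout.\<close>

lemma S5_unbox_eq:
  assumes N: "S5_op N" and "mcs \<Gamma>" "mcs \<Delta>" "unbox N \<Gamma> \<subseteq> \<Delta>"
  shows "unbox N \<Delta> = unbox N \<Gamma>"
proof
  show "unbox N \<Gamma> \<subseteq> unbox N \<Delta>"
  proof
    fix A assume "A \<in> unbox N \<Gamma>"
    then have "N (N A) \<in> \<Gamma>"
      using mcs_mp[OF assms(2), of "N A" "N (N A)"] N S5_axiom.intros(3)
      by (auto simp: S5_op_def unbox_def)
    then show "A \<in> unbox N \<Delta>" using assms(4) by (auto simp: unbox_def)
  qed
  show "unbox N \<Delta> \<subseteq> unbox N \<Gamma>"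
  proof
    fix A assume "A \<in> unbox N \<Delta>"
    show "A \<in> unbox N \<Gamma>"
    proof (rule ccontr)
      \<comment> \<open>The euclidean axiom speaks of operators applied to negated formulas, so
        \<open>A\<close> is exchanged for its double negation.\<close>
      let ?B = "Neg (Neg A)"
      have dn: "\<turnstile> Imp (N A) (N ?B)" "\<turnstile> Imp (N ?B) (N A)"
        by (intro normal_op_mono[OF S5_op_normal[OF N]] derivable_consequence[of "[]"]; simp)+
      assume "A \<notin> unbox N \<Gamma>"
      then have "N ?B \<notin> \<Gamma>" using mcs_mp[OF assms(2) dn(2)] by (auto simp: unbox_def)
      then have "Neg (N ?B) \<in> \<Gamma>" using assms(2) by (simp add: mcs_Neg)
      then have "N (Neg (N ?B)) \<in> \<Gamma>"
        using mcs_mp[OF assms(2), of "Neg (N ?B)" "N (Neg (N ?B))"] N S5_axiom.intros(4)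
        by (auto simp: S5_op_def)
      then have "Neg (N ?B) \<in> \<Delta>" using assms(4) by (auto simp: unbox_def)
      moreover have "N ?B \<in> \<Delta>"
        using mcs_mp[OF assms(3) dn(1)] \<open>A \<in> unbox N \<Delta>\<close> by (auto simp: unbox_def)
      ultimately show False using assms(3) by (simp add: mcs_Neg)
    qed
  qed
qed

lemma S5_witness:
  assumes "S5_op N" "mcs \<Gamma>" "N B \<notin> \<Gamma>"
  obtains \<Delta> where "mcs \<Delta>" "unbox N \<Delta> = unbox N \<Gamma>" "B \<notin> \<Delta>"
  using mcs_witness[OF S5_op_normal[OF assms(1)] assms(2,3)] S5_unbox_eq[OF assms(1,2)]
  by metis

lemma unbox_Know_mono:
  assumes "mcs \<Gamma>" "mcs \<Delta>" "unbox Know \<Gamma> \<subseteq> \<Delta>"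
  shows "unbox Know \<Gamma> \<subseteq> unbox Know \<Delta>"
proof
  fix A assume "A \<in> unbox Know \<Gamma>"
  then have "Know (Know A) \<in> \<Gamma>"
    using mcs_axiom[OF assms(1) A7[OF S4_axiom.intros(3)]] by (auto simp: unbox_def)
  then show "A \<in> unbox Know \<Delta>" using assms(3) by (auto simp: unbox_def)
qed

lemma mcs_Know_imp: "\<lbrakk>mcs \<Gamma>; Know A \<in> \<Gamma>\<rbrakk> \<Longrightarrow> A \<in> \<Gamma>"
  using mcs_axiom[OF _ A7[OF S4_axiom.intros(2)]] by blast

text \<open>Positive introspection and (A8) give \<open>Box (Know (Box (Know A)))\<close>;
  reflexivity, applied twice below the outer \<open>Box\<close>, leaves the claim.\<close>

lemma mcs_Box_Know:
  assumes "mcs \<Gamma>" "Know A \<in> \<Gamma>"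
  shows "Box (Know A) \<in> \<Gamma>"
proof -
  have "Know (Know A) \<in> \<Gamma>"
    using mcs_axiom[OF assms(1) A7[OF S4_axiom.intros(3)]] assms(2) by blast
  then have *: "Box (Know (Box (Know A))) \<in> \<Gamma>" using mcs_axiom[OF assms(1) A8] by blast
  have "\<turnstile> Imp (Know (Box (Know A))) (Box (Know A))" "\<turnstile> Imp (Box (Know A)) (Know A)"
    by (rule Ax[OF A7[OF S4_axiom.intros(2)]], rule Ax[OF A1_Box[OF S5_axiom.intros(2)]])
  then have "\<turnstile> Imp (Know (Box (Know A))) (Know A)"
    by (intro derivable_consequence[of "[Imp (Know (Box (Know A))) (Box (Know A)),
        Imp (Box (Know A)) (Know A)]"]) auto
  from normal_op_mono[OF S5_op_normal[OF S5_op_Box] this]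
  show ?thesis using * mcs_mp[OF assms(1)] by blast
qed

text \<open>The first claim is (A5) used twice: once for \<open>Just (Bang t) (Just t A)\<close>,
  then on this formula. It allows one relation to play both epistemic roles.\<close>

lemma mcs_Know_Just:
  assumes "mcs \<Gamma>" "Just t A \<in> \<Gamma>"
  shows "Know (Just t A) \<in> \<Gamma>" "Know A \<in> \<Gamma>" "Just (Bang t) (Just t A) \<in> \<Gamma>"
  using mcs_axiom[OF assms(1) A5] assms by (auto simp: mcs_Conj)

text \<open>Knowledge is settled, hence a property of the whole class; a moment can be compared with
  others through its representative alone.\<close>

lemma unbox_Know_box_class:
  assumes "mcs \<Gamma>" "mcs \<Delta>" "unbox Box \<Gamma> = unbox Box \<Delta>"
  shows "unbox Know \<Gamma> = unbox Know \<Delta>"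
proof -
  have "unbox Know X \<subseteq> unbox Know Y" if "mcs X" "mcs Y" "unbox Box X = unbox Box Y" for X Y
  proof
    fix A assume "A \<in> unbox Know X"
    then have "Know A \<in> unbox Box X" using mcs_Box_Know[OF that(1)] by (auto simp: unbox_def)
    then have "Box (Know A) \<in> Y" using that(3) by (auto simp: unbox_def)
    from S5_T[OF S5_op_Box that(2) this] show "A \<in> unbox Know Y" by (simp add: unbox_def)
  qed
  then show ?thesis using assms by blast
qed

lemma Just_unbox_Know:
  assumes "mcs \<Gamma>" "mcs \<Delta>" "unbox Know \<Gamma> \<subseteq> unbox Know \<Delta>" "Just t A \<in> \<Gamma>"
  shows "Just t A \<in> \<Delta>"
  using assms mcs_Know_Just(1)[OF assms(1,4)] mcs_Know_imp[OF assms(2)] by (auto simp: unbox_def)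

section \<open>Independence of agents\<close>

text \<open>The canonical counterpart of (A3). An inconsistency would involve finitely many stit
  formulas; those of agent \<open>j\<close> are merged into one \<open>Stit j (B j)\<close>. This is
  possible in \<open>R\<close> because \<open>G j\<close> belongs to the same
  \<open>Box\<close>-class, and (A3) provides a set that contains all of them together with
  \<open>unbox Box R\<close>.\<close>

lemma mcs_independence:
  fixes R :: "'a::finite form set" and G :: "'a \<Rightarrow> 'a form set"
  assumes R: "mcs R" and G: "\<And>j. mcs (G j)" "\<And>j. unbox Box (G j) = unbox Box R"
  obtains \<Delta> where "mcs \<Delta>" "unbox Box \<Delta> = unbox Box R"
    "\<And>j. unbox (Stit j) \<Delta> = unbox (Stit j) (G j)"
proof -
  let ?X = "unbox Box R \<union> (\<Union>j. Stit j ` unbox (Stit j) (G j))"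
  have "con ?X"
  proof
    assume "?X \<tturnstile> Bot"
    then obtain As where As: "set As \<subseteq> ?X" "set As \<tturnstile> Bot" using der_finite by blast
    have "\<exists>Bs. set Bs = {A. Stit j A \<in> set As} \<inter> unbox (Stit j) (G j)" for j
    proof (rule finite_list)
      have "finite (Stit j -` set As)" by (intro finite_vimageI) (auto simp: inj_def)
      then show "finite ({A. Stit j A \<in> set As} \<inter> unbox (Stit j) (G j))"
        by (auto simp: vimage_def)
    qed
    then obtain Bs where Bs: "set (Bs j) = {A. Stit j A \<in> set As} \<inter> unbox (Stit j) (G j)" for j
      by metis
    \<comment> \<open>For an agent without assumptions the list is empty and \<open>B j\<close> is
      the tautology \<open>Neg Bot\<close>, so (A3) can be applied to all agents at once.\<close>
    define B where "B j = BigConj (Bs j)" for j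
    have "Stit j (B j) \<in> G j" for j
    proof -
      have "unbox (Stit j) (G j) \<tturnstile> B j"
        using Bs[of j] unfolding B_def
        by (intro der_consequence[of "Bs j"]) (auto simp: boolean_value_BigConj intro: der_assumption)
      then have "G j \<tturnstile> Stit j (B j)" by (rule der_normal_op[OF S5_op_normal[OF S5_op_Stit]])
      then show ?thesis by (rule mcs_der[OF G(1)])
    qed
    then have dia: "Dia (Stit j (B j)) \<in> R" for j
      using S5_T[OF S5_op_Box G(1)[of j], of "Neg (Stit j (B j))"] G R
      by (auto simp: mcs_Neg unbox_def)
    obtain js :: "'a list" where js: "set js = UNIV" "distinct js"
      using finite_distinct_list[OF finite_UNIV] by blast
    let ?C = "BigConj (map (\<lambda>j. Stit j (B j)) js)"
    have "axiom (Imp (BigConj (map (\<lambda>j. Dia (Stit j (B j))) js)) (Dia ?C))"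
      using A3[of "map (\<lambda>j. (j, B j)) js"] js by (cases "js = []") (auto simp: comp_def)
    moreover have "BigConj (map (\<lambda>j. Dia (Stit j (B j))) js) \<in> R"
      using dia R by (auto simp only: mcs_BigConj set_map)
    ultimately have "Dia ?C \<in> R" by (rule mcs_axiom[OF R])
    then have "Box (Neg ?C) \<notin> R" using R by (simp add: mcs_Neg)
    then obtain \<Delta> where \<Delta>: "mcs \<Delta>" "unbox Box R \<subseteq> \<Delta>" "Neg ?C \<notin> \<Delta>"
      using mcs_witness[OF S5_op_normal[OF S5_op_Box] R] by blast
    then have C: "Stit j (B j) \<in> \<Delta>" for j using js by (auto simp: mcs_Neg mcs_BigConj)
    have "Stit j A \<in> \<Delta>" if "A \<in> set (Bs j)" for j A
    proof -
      have "\<turnstile> Imp (B j) A"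
        using that by (intro derivable_consequence[of "[]"]) (auto simp: B_def boolean_value_BigConj)
      from mcs_mp[OF \<Delta>(1) normal_op_mono[OF S5_op_normal[OF S5_op_Stit] this] C]
      show ?thesis .
    qed
    then have "C \<in> \<Delta>" if "C \<in> set As" for C
      using that As(1) \<Delta>(2) Bs by blast
    then have "set As \<subseteq> \<Delta>" by blast
    then show False using As(2) \<Delta>(1) mcs_con der_mono by blast
  qed
  then obtain \<Delta> where \<Delta>: "?X \<subseteq> \<Delta>" "mcs \<Delta>" by (rule lindenbaum)
  show thesis
  proof (rule that[OF \<Delta>(2)])
    show "unbox Box \<Delta> = unbox Box R"
      using S5_unbox_eq[OF S5_op_Box R \<Delta>(2)] \<Delta>(1) by blast
    show "unbox (Stit j) \<Delta> = unbox (Stit j) (G j)" for j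
    proof (rule S5_unbox_eq[OF S5_op_Stit G(1) \<Delta>(2)])
      show "unbox (Stit j) (G j) \<subseteq> \<Delta>"
        using S5_T[OF S5_op_Stit \<Delta>(2)] \<Delta>(1) by blast
    qed
  qed
qed

section \<open>Settling the presented proofs\<close>

text \<open>(R4) lifted to sets. A refutation uses finitely many formulas; the known ones are merged
  into a single \<open>Know ?C\<close>, as the rule demands, and the rule then turns it into a
  refutation without boxes.\<close>

lemma con_Box_Ev:
  assumes "con (Know ` N \<union> Ev ` T)"
  shows "con (Know ` N \<union> (\<lambda>t. Box (Ev t)) ` T)"
proof
  assume "Know ` N \<union> (\<lambda>t. Box (Ev t)) ` T \<tturnstile> Bot"
  then obtain As where As: "set As \<subseteq> Know ` N \<union> (\<lambda>t. Box (Ev t)) ` T" "\<turnstile> foldr Imp As Bot"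
    unfolding der_def by blast
  have "finite (Know -` set As)" "finite ((\<lambda>t. Box (Ev t)) -` set As)"
    by (auto intro!: finite_vimageI simp: inj_def)
  then have "finite (Know -` set As \<inter> N)" "finite ((\<lambda>t. Box (Ev t)) -` set As \<inter> T)" by auto
  then obtain Ns ts where Ns: "set Ns = Know -` set As \<inter> N"
    and ts: "set ts = (\<lambda>t. Box (Ev t)) -` set As \<inter> T"
    using finite_list by metis
  have cover: "\<exists>A\<in>set Ns. C = Know A" if "C \<in> set As" "C \<notin> (\<lambda>t. Box (Ev t)) ` set ts" for C
    using that As(1) Ns ts by auto
  let ?C = "BigConj Ns"
  have K: "\<turnstile> Imp (Know ?C) (Know A)" if "A \<in> set Ns" for A
    using that by (intro normal_op_mono[OF normal_op_Know] derivable_consequence[of "[]"])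
      (auto simp: boolean_value_BigConj)
  have KC: "Know ` N \<tturnstile> Know ?C"
  proof (rule der_normal_op[OF normal_op_Know])
    show "unbox Know (Know ` N) \<tturnstile> ?C"
      using Ns by (intro der_consequence[of Ns])
        (auto simp: boolean_value_BigConj unbox_def intro: der_assumption)
  qed
  have imp: "\<turnstile> Imp (Know ?C) (BigDisj (map (\<lambda>t. Neg (Box (Ev t))) ts))"
  proof (rule derivable_consequence)
    show "\<forall>A\<in>set (foldr Imp As Bot # map (\<lambda>A. Imp (Know ?C) (Know A)) Ns). \<turnstile> A"
      using As(2) K by auto
    fix v
    assume v: "\<forall>A\<in>set (foldr Imp As Bot # map (\<lambda>A. Imp (Know ?C) (Know A)) Ns). boolean_value v A"
    then obtain C where C: "C \<in> set As" "\<not> boolean_value v C"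
      by (auto simp: boolean_value_foldr_Imp)
    then show "boolean_value v (Imp (Know ?C) (BigDisj (map (\<lambda>t. Neg (Box (Ev t))) ts)))"
      using v cover[OF C(1)] by (cases "C \<in> (\<lambda>t. Box (Ev t)) ` set ts")
        (auto simp: boolean_value_BigDisj)
  qed
  \<comment> \<open>(R4) asks for a nonempty list; for the empty one both disjunctions are
    \<open>Bot\<close>.\<close>
  have "\<turnstile> Imp (Know ?C) (BigDisj (map (\<lambda>t. Neg (Ev t)) ts))"
    using imp R4 by (cases "ts = []") auto
  then have "Know ` N \<union> Ev ` T \<tturnstile> Bot"
    using KC ts
    by (intro der_consequence[of "Know ?C # Imp (Know ?C) (BigDisj (map (\<lambda>t. Neg (Ev t)) ts)) # map Ev ts"])
      (auto simp: boolean_value_BigDisj intro: der_theorem der_assumption der_mono)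
  then show False using assms by blast
qed

definition saturated :: "'a form set \<Rightarrow> bool" where
  "saturated \<Gamma> \<longleftrightarrow> (\<forall>t. Ev t \<in> \<Gamma> \<longrightarrow> Box (Ev t) \<in> \<Gamma>)"

text \<open>Adding to the known formulas a maximal consistent set of formulas \<open>\<box>Et\<close> leaves
  no room for further \<open>Et\<close>, by the previous lemma.\<close>

lemma saturated_successor:
  assumes "mcs \<Gamma>"
  obtains S where "mcs S" "saturated S" "unbox Know \<Gamma> \<subseteq> unbox Know S"
    "\<And>t. Ev t \<in> \<Gamma> \<Longrightarrow> Box (Ev t) \<in> S"
proof -
  let ?K = "Know ` unbox Know \<Gamma>" and ?B = "\<lambda>t. Box (Ev t)"
  have "?K \<union> Ev ` {t. Ev t \<in> \<Gamma>} \<subseteq> \<Gamma>" by (auto simp: unbox_def)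
  then have "con (?K \<union> Ev ` {t. Ev t \<in> \<Gamma>})" using mcs_con[OF assms] der_mono by blast
  from maximal_con_extension[OF con_Box_Ev[OF this], of "range ?B"]
  obtain \<Delta> where \<Delta>: "?K \<union> ?B ` {t. Ev t \<in> \<Gamma>} \<subseteq> \<Delta>"
    "\<Delta> \<subseteq> ?K \<union> ?B ` {t. Ev t \<in> \<Gamma>} \<union> range ?B" "con \<Delta>"
    "\<forall>A\<in>range ?B. con (insert A \<Delta>) \<longrightarrow> A \<in> \<Delta>" by blast
  obtain S where S: "\<Delta> \<subseteq> S" "mcs S" using lindenbaum[OF \<Delta>(3)] by blast
  have "Box (Ev t) \<in> S" if t: "Ev t \<in> S" for t
  proof -
    let ?T = "insert t {t. ?B t \<in> \<Delta>}"
    have "Ev u \<in> S" if "?B u \<in> \<Delta>" for u using S5_T[OF S5_op_Box S(2)] that S(1) by blast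
    then have "?K \<union> Ev ` ?T \<subseteq> S" using \<Delta>(1) S(1) t by blast
    then have "con (?K \<union> Ev ` ?T)" using mcs_con[OF S(2)] der_mono by blast
    then have "con (?K \<union> ?B ` ?T)" by (rule con_Box_Ev)
    moreover have "insert (?B t) \<Delta> \<subseteq> ?K \<union> ?B ` ?T" using \<Delta>(1,2) by blast
    ultimately have "con (insert (?B t) \<Delta>)" using der_mono by blast
    then show ?thesis using \<Delta>(4) S(1) by blast
  qed
  moreover have "unbox Know \<Gamma> \<subseteq> unbox Know S" using \<Delta>(1) S(1) by (auto simp: unbox_def)
  moreover have "Box (Ev t) \<in> S" if "Ev t \<in> \<Gamma>" for t using \<Delta>(1) S(1) that by blast
  ultimately show thesis using that[OF S(2)] by (auto simp: saturated_def)
qed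

section \<open>Labelled trees\<close>

text \<open>\<open>rep x\<close> is a representative of the \<open>\<box>\<close>-class realised at the moment \<open>x\<close>; the label
  \<open>lab x y\<close> is the member of this class realised at \<open>x\<close> by the histories through the later
  moment \<open>y\<close>. The root only provides a common past, and nothing is claimed about the formulas
  true there.\<close>

locale labelled_tree =
  fixes W :: "'w set" and le :: "'w \<Rightarrow> 'w \<Rightarrow> bool" and root :: 'w
    and rep :: "'w \<Rightarrow> 'a::finite form set" and lab :: "'w \<Rightarrow> 'w \<Rightarrow> 'a form set"
  assumes le_refl: "x \<in> W \<Longrightarrow> le x x"
    and le_antisym: "\<lbrakk>x \<in> W; y \<in> W; le x y; le y x\<rbrakk> \<Longrightarrow> x = y"
    and le_trans: "\<lbrakk>x \<in> W; y \<in> W; z \<in> W; le x y; le y z\<rbrakk> \<Longrightarrow> le x z"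
    and le_linear: "\<lbrakk>x \<in> W; y \<in> W; z \<in> W; le x z; le y z\<rbrakk> \<Longrightarrow> le x y \<or> le y x"
    and root: "root \<in> W"
    and root_le: "x \<in> W \<Longrightarrow> le root x"
    and rep_root: "rep root = {}"
    and rep_mcs: "\<lbrakk>x \<in> W; x \<noteq> root\<rbrakk> \<Longrightarrow> mcs (rep x)"
    and rep_surj: "mcs \<Gamma> \<Longrightarrow> \<exists>x\<in>W. x \<noteq> root \<and> rep x = \<Gamma>"
    and lab_local: "\<lbrakk>x \<in> W; y \<in> W; z \<in> W; le x y; x \<noteq> y; le y z\<rbrakk> \<Longrightarrow> lab x z = lab x y"
    and lab_class: "\<lbrakk>x \<in> W; y \<in> W; le x y; x \<noteq> y; x \<noteq> root\<rbrakk>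
      \<Longrightarrow> mcs (lab x y) \<and> unbox Box (lab x y) = unbox Box (rep x)"
    and lab_surj: "\<lbrakk>x \<in> W; x \<noteq> root; mcs \<Gamma>; unbox Box \<Gamma> = unbox Box (rep x)\<rbrakk>
      \<Longrightarrow> \<exists>y\<in>W. le x y \<and> x \<noteq> y \<and> lab x y = \<Gamma>"
    and know_mono: "\<lbrakk>x \<in> W; y \<in> W; le x y\<rbrakk> \<Longrightarrow> unbox Know (rep x) \<subseteq> unbox Know (rep y)"
    and lab_settled: "\<lbrakk>x \<in> W; y \<in> W; le x y; x \<noteq> y; Ev t \<in> lab x y\<rbrakk> \<Longrightarrow> Box (Ev t) \<in> rep y"
    and settled_lab: "\<lbrakk>y \<in> W; y \<noteq> root; Box (Ev t) \<in> rep y\<rbrakk>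
      \<Longrightarrow> \<exists>x\<in>W. le x y \<and> x \<noteq> y \<and> Ev t \<in> lab x y"
    and root_unsettled: "\<exists>y\<in>W. root \<noteq> y \<and> Ev t \<notin> lab root y"
    and lab_root: "\<lbrakk>y \<in> W; root \<noteq> y\<rbrakk> \<Longrightarrow> unbox (Stit j) (lab root y) = {}"
begin

definition P :: "('w \<times> 'w) set" where
  "P = {(x, y). x \<in> W \<and> y \<in> W \<and> le x y}"

definition hs :: "'w \<Rightarrow> 'w set set" where
  "hs m = {h \<in> Chains P. (\<forall>h'\<in>Chains P. h \<subseteq> h' \<longrightarrow> h' = h) \<and> m \<in> h}"

text \<open>The chosen \<open>y\<close> is immaterial: by \<open>lab_local\<close> all later moments
  of \<open>h\<close> give the same label.\<close>

definition L :: "'w \<Rightarrow> 'w set \<Rightarrow> 'a form set" where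
  "L m h = lab m (SOME y. y \<in> h \<and> le m y \<and> m \<noteq> y)"

text \<open>As \<open>rep root\<close> is empty, the root is related to every moment, in accordance
  with its lying below all of them.\<close>

definition epist :: "('w \<times> 'w) set" where
  "epist = {(x, y). x \<in> W \<and> y \<in> W \<and> unbox Know (rep x) \<subseteq> unbox Know (rep y)}"

text \<open>The disjunct \<open>\<turnstile> t:A\<close> of the evidence matters only at the root, where \<open>rep\<close> is empty.\<close>

definition T :: "('a, 'w) jstit" where
  "T = \<lparr>moments = W, prec = P,
    choice = (\<lambda>m j. (\<lambda>h. {h' \<in> hs m. unbox (Stit j) (L m h') = unbox (Stit j) (L m h)}) ` hs m),
    act = (\<lambda>m h. {t. Ev t \<in> L m h}), rel = epist, rel_e = epist,
    evid = (\<lambda>m t. {A. \<turnstile> Just t A \<or> Just t A \<in> rep m}),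
    val = (\<lambda>p. {(m, h). m \<in> W \<and> h \<in> hs m \<and> Atom p \<in> L m h})\<rparr>"

lemma T_simps [simp]:
  "moments T = W" "prec T = P" "rel T = epist" "rel_e T = epist"
  "choice T m j = (\<lambda>h. {h' \<in> hs m. unbox (Stit j) (L m h') = unbox (Stit j) (L m h)}) ` hs m"
  "act T m h = {t. Ev t \<in> L m h}" "evid T m t = {A. \<turnstile> Just t A \<or> Just t A \<in> rep m}"
  "val T p = {(m, h). m \<in> W \<and> h \<in> hs m \<and> Atom p \<in> L m h}"
  by (simp_all add: T_def)

lemma hist_T [simp]: "hist T m = hs m"
  by (auto simp: hist_def histories_def hs_def)

section \<open>Histories of the tree and their labels\<close>

lemma P_iff: "(x, y) \<in> P \<longleftrightarrow> x \<in> W \<and> y \<in> W \<and> le x y"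
  by (simp add: P_def)

lemma hs_W: "\<lbrakk>h \<in> hs m; x \<in> h\<rbrakk> \<Longrightarrow> x \<in> W"
  by (auto simp: hs_def Chains_def P_iff)

lemma hs_mem: "h \<in> hs m \<Longrightarrow> m \<in> h"
  by (simp add: hs_def)

lemma hs_linear: "\<lbrakk>h \<in> hs m; x \<in> h; y \<in> h\<rbrakk> \<Longrightarrow> le x y \<or> le y x"
  by (auto simp: hs_def Chains_def P_iff)

lemma hs_shift: "\<lbrakk>h \<in> hs m; x \<in> h\<rbrakk> \<Longrightarrow> h \<in> hs x"
  by (simp add: hs_def)

lemma hs_maximal:
  assumes h: "h \<in> hs m" and x: "x \<in> W" and comp: "\<And>y. y \<in> h \<Longrightarrow> le x y \<or> le y x"
  shows "x \<in> h"
proof -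
  have "insert x h \<in> Chains P"
    using hs_linear[OF h] hs_W[OF h] x comp le_refl[OF x] by (auto simp: Chains_def P_iff)
  moreover have "\<And>h'. \<lbrakk>h' \<in> Chains P; h \<subseteq> h'\<rbrakk> \<Longrightarrow> h' = h" using h by (simp add: hs_def)
  ultimately show ?thesis by blast
qed

lemma hs_downward:
  assumes h: "h \<in> hs m" and x: "x \<in> W" "y \<in> h" "le x y"
  shows "x \<in> h"
proof (rule hs_maximal[OF h x(1)])
  fix z assume z: "z \<in> h"
  note W = hs_W[OF h z] hs_W[OF h x(2)]
  show "le x z \<or> le z x"
    using hs_linear[OF h z x(2)]
  proof
    assume "le z y"
    then show ?thesis using le_linear[OF x(1) W x(3)] by blast
  next
    assume "le y z"
    then show ?thesis using le_trans[OF x(1) W(2,1) x(3)] by blast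
  qed
qed

lemma hs_exists:
  assumes "x \<in> W" "y \<in> W" "le x y"
  obtains h where "h \<in> hs x" "y \<in> h"
proof -
  have "{x, y} \<in> Chains P" using assms le_refl by (auto simp: Chains_def P_iff)
  from maximal_Chains_extension[OF this]
  obtain h where "h \<in> Chains P" "{x, y} \<subseteq> h" "\<And>h'. \<lbrakk>h' \<in> Chains P; h \<subseteq> h'\<rbrakk> \<Longrightarrow> h' = h" by metis
  then show thesis using that[of h] by (simp add: hs_def)
qed

lemma no_last:
  assumes "x \<in> W"
  obtains y where "y \<in> W" "le x y" "x \<noteq> y"
proof (cases "x = root")
  case True
  then show thesis using root_unsettled root_le that by metis
next
  case False
  then show thesis using lab_surj[OF assms False rep_mcs[OF assms False] refl] that by blast
qed

text \<open>A history ending at \<open>m\<close> would contain only predecessors of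
  \<open>m\<close>, so any later moment would prolong it. Thus \<open>L\<close> always has a moment
  to look at.\<close>

lemma hs_later:
  assumes h: "h \<in> hs m"
  obtains y where "y \<in> h" "le m y" "m \<noteq> y"
proof -
  have "\<exists>y\<in>h. le m y \<and> m \<noteq> y"
  proof (rule ccontr)
    assume *: "\<not> ?thesis"
    have m: "m \<in> W" using hs_W[OF h hs_mem[OF h]] .
    have below: "le y m" if "y \<in> h" for y
      using hs_linear[OF h that hs_mem[OF h]] le_refl[OF m] * that by auto
    obtain z where z: "z \<in> W" "le m z" "m \<noteq> z" using no_last[OF m] .
    have "z \<in> h"
    proof (rule hs_maximal[OF h z(1)])
      fix y assume y: "y \<in> h"
      show "le z y \<or> le y z" using le_trans[OF hs_W[OF h y] m z(1) below[OF y] z(2)] by blast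
    qed
    then show False using * z by blast
  qed
  then show thesis using that by blast
qed

lemma L_eq:
  assumes h: "h \<in> hs m" and y: "y \<in> h" "le m y" "m \<noteq> y"
  shows "L m h = lab m y"
proof -
  define x where "x = (SOME y. y \<in> h \<and> le m y \<and> m \<noteq> y)"
  have x: "x \<in> h \<and> le m x \<and> m \<noteq> x"
    unfolding x_def by (rule someI[of _ y]) (use y in blast)
  have m: "m \<in> W" using hs_W[OF h hs_mem[OF h]] .
  have W: "x \<in> W" "y \<in> W" using hs_W[OF h] x y by auto
  have "lab m x = lab m y"
    using hs_linear[OF h, of x y] x y lab_local[OF m W] lab_local[OF m W(2,1)] by auto
  then show ?thesis by (simp add: L_def x_def)
qed

lemma L_class:
  assumes h: "h \<in> hs m" and m: "m \<noteq> root"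
  shows "mcs (L m h)" "unbox Box (L m h) = unbox Box (rep m)"
proof -
  obtain y where y: "y \<in> h" "le m y" "m \<noteq> y" using hs_later[OF h] .
  have W: "m \<in> W" "y \<in> W" using hs_W[OF h] hs_mem[OF h] y by auto
  show "mcs (L m h)" "unbox Box (L m h) = unbox Box (rep m)"
    using lab_class[OF W y(2,3) m] L_eq[OF h y] by auto
qed

lemma L_surj:
  assumes m: "m \<in> W" "m \<noteq> root" and \<Gamma>: "mcs \<Gamma>" "unbox Box \<Gamma> = unbox Box (rep m)"
  obtains h where "h \<in> hs m" "L m h = \<Gamma>"
proof -
  obtain y where y: "y \<in> W" "le m y" "m \<noteq> y" "lab m y = \<Gamma>" using lab_surj[OF m \<Gamma>] by blast
  obtain h where h: "h \<in> hs m" "y \<in> h" using hs_exists[OF m(1) y(1,2)] .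
  then show thesis using that[of h] L_eq[OF h(1,2) y(2,3)] y(4) by simp
qed

lemma L_root:
  assumes h: "h \<in> hs root"
  shows "unbox (Stit j) (L root h) = {}"
proof -
  obtain y where y: "y \<in> h" "le root y" "root \<noteq> y" using hs_later[OF h] .
  then show ?thesis using L_eq[OF h y] lab_root hs_W[OF h] by simp
qed

text \<open>The \<open>Box\<close> case of the truth lemma, stated for labels since the conditions
  on presented proofs need it before truth is considered.\<close>

lemma settled_iff:
  assumes m: "m \<in> W" "m \<noteq> root"
  shows "(\<forall>h\<in>hs m. A \<in> L m h) \<longleftrightarrow> Box A \<in> rep m"
proof
  assume *: "\<forall>h\<in>hs m. A \<in> L m h"
  show "Box A \<in> rep m"
  proof (rule ccontr)
    assume "Box A \<notin> rep m"
    from S5_witness[OF S5_op_Box rep_mcs[OF m] this]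
    obtain \<Delta> where \<Delta>: "mcs \<Delta>" "unbox Box \<Delta> = unbox Box (rep m)" "A \<notin> \<Delta>" .
    obtain h where "h \<in> hs m" "L m h = \<Delta>" using L_surj[OF m \<Delta>(1,2)] .
    then show False using * \<Delta>(3) by blast
  qed
next
  assume *: "Box A \<in> rep m"
  show "\<forall>h\<in>hs m. A \<in> L m h"
  proof
    fix h assume h: "h \<in> hs m"
    have "Box A \<in> L m h" using L_class(2)[OF h m(2)] * by (auto simp: unbox_def)
    then show "A \<in> L m h" using S5_T[OF S5_op_Box L_class(1)[OF h m(2)]] by blast
  qed
qed

text \<open>Nothing precedes the root, so a proof presented there along all histories would violate
  the ban on new guaranteed proofs.\<close>

lemma root_unsettled_L: "\<exists>h\<in>hs root. Ev t \<notin> L root h"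
proof -
  obtain y where y: "y \<in> W" "root \<noteq> y" "Ev t \<notin> lab root y" using root_unsettled by blast
  obtain h where h: "h \<in> hs root" "y \<in> h" using hs_exists[OF root y(1) root_le[OF y(1)]] .
  then show ?thesis using L_eq[OF h root_le[OF y(1)] y(2)] y(3) by blast
qed

lemma presented_settled:
  assumes m: "m \<in> W" and "\<And>h. h \<in> hs m \<Longrightarrow> Ev t \<in> L m h"
  shows "m \<noteq> root" "Box (Ev t) \<in> rep m"
proof -
  show "m \<noteq> root" using root_unsettled_L[of t] assms(2) by blast
  then show "Box (Ev t) \<in> rep m" using settled_iff[OF m] assms(2) by blast
qed

section \<open>The epistemic relation and the evidence\<close>

text \<open>A maximal consistent set knows \<open>Neg Bot\<close>, the root knows nothing. Hence the
  truth lemma, started elsewhere, never arrives at the root.\<close>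

lemma epist_not_root:
  assumes "(x, y) \<in> epist" "x \<noteq> root"
  shows "y \<noteq> root"
proof
  assume "y = root"
  then have e: "unbox Know (rep x) = {}" and x: "x \<in> W"
    using assms(1) rep_root by (auto simp: epist_def unbox_def)
  have "\<turnstile> Know (Neg Bot :: 'a form)" by (intro R2 derivable_consequence[of "[]"]) auto
  then have "Know (Neg Bot) \<in> rep x" using mcs_theorem[OF rep_mcs[OF x assms(2)]] by blast
  then show False using e by (auto simp: unbox_def)
qed

lemma evid_rep:
  assumes "x \<in> W" "x \<noteq> root"
  shows "\<turnstile> A \<or> A \<in> rep x \<longleftrightarrow> A \<in> rep x"
  using mcs_theorem[OF rep_mcs[OF assms]] by blast

lemma evid_mp:
  assumes x: "x \<in> W" and imp: "\<turnstile> Imp A B" and A: "\<turnstile> A \<or> A \<in> rep x"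
  shows "\<turnstile> B \<or> B \<in> rep x"
proof (cases "x = root")
  case True
  then show ?thesis using R1[OF _ imp] A rep_root by blast
next
  case False
  then show ?thesis using A mcs_mp[OF rep_mcs[OF x False] imp] evid_rep[OF x False, of A] by blast
qed

lemma evid_mp2:
  assumes x: "x \<in> W" and imp: "\<turnstile> Imp A (Imp B C)"
    and A: "\<turnstile> A \<or> A \<in> rep x" and B: "\<turnstile> B \<or> B \<in> rep x"
  shows "\<turnstile> C \<or> C \<in> rep x"
proof (cases "x = root")
  case True
  then have "\<turnstile> A" "\<turnstile> B" using A B rep_root by auto
  then show ?thesis using R1[OF _ imp] R1 by blast
next
  case False
  note mcs = rep_mcs[OF x False]
  have "Imp B C \<in> rep x" "B \<in> rep x"
    using mcs_mp[OF mcs imp] A B evid_rep[OF x False] by blast+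
  then show ?thesis using mcs by (simp add: mcs_Neg mcs_Conj)
qed

lemma evid_mono:
  assumes e: "(x, y) \<in> epist" and J: "\<turnstile> Just t A \<or> Just t A \<in> rep x"
  shows "\<turnstile> Just t A \<or> Just t A \<in> rep y"
proof (cases "x = root")
  case True
  then show ?thesis using J rep_root by auto
next
  case False
  have W: "x \<in> W" "y \<in> W" and k: "unbox Know (rep x) \<subseteq> unbox Know (rep y)"
    using e by (auto simp: epist_def)
  note mcs = rep_mcs[OF W(1) False] rep_mcs[OF W(2) epist_not_root[OF e False]]
  show ?thesis using Just_unbox_Know[OF mcs k] J by blast
qed

section \<open>The model conditions\<close>

lemma cell_T:
  assumes h: "h \<in> hs m"
  shows "cell T m j h = {h' \<in> hs m. unbox (Stit j) (L m h') = unbox (Stit j) (L m h)}"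
  unfolding cell_def by (rule the_equality) (use h in auto)

lemma L_undivided:
  assumes "h \<in> hs m" "h' \<in> hs m" "undivided T m h h'"
  shows "L m h = L m h'"
proof -
  obtain y where "(m, y) \<in> P" "m \<noteq> y" "y \<in> h" "y \<in> h'"
    using assms(3) by (auto simp: undivided_def sprec_def)
  then show ?thesis using L_eq assms(1,2) by (simp add: P_iff)
qed

lemma L_independence:
  assumes m: "m \<in> W" and g: "\<And>j. g j \<in> hs m"
  obtains h where "h \<in> hs m" "\<And>j. unbox (Stit j) (L m h) = unbox (Stit j) (L m (g j))"
proof (cases "m = root")
  case True
  \<comment> \<open>Labels at the root contain no stit formulas, so each agent has a single cell
    there and any history will do; \<open>undefined\<close> is just some agent.\<close>
  then show thesis using that[OF g, of undefined] L_root g by simp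
next
  case False
  obtain \<Delta> where \<Delta>: "mcs \<Delta>" "unbox Box \<Delta> = unbox Box (rep m)"
    "\<And>j. unbox (Stit j) \<Delta> = unbox (Stit j) (L m (g j))"
    using mcs_independence[of "rep m" "\<lambda>j. L m (g j)"] rep_mcs[OF m False] L_class[OF g False]
    by metis
  obtain h where "h \<in> hs m" "L m h = \<Delta>" using L_surj[OF m False \<Delta>(1,2)] .
  then show thesis using that[of h] \<Delta>(3) by simp
qed

lemma sprec_T: "(x, y) \<in> sprec T \<longleftrightarrow> x \<in> W \<and> y \<in> W \<and> le x y \<and> x \<noteq> y"
  by (auto simp: sprec_def P_iff)

lemma jstit_model_T: "jstit_model T"
proof
  show "moments T \<noteq> {}" using root by auto
  show "partial_order_on (moments T) (prec T)"
    unfolding partial_order_on_def preorder_on_def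
  proof (intro conjI)
    show "refl_on (moments T) (prec T)" using le_refl by (auto simp: refl_on_def P_iff)
    show "trans (prec T)"
    proof (rule transI)
      show "(x, z) \<in> prec T" if "(x, y) \<in> prec T" "(y, z) \<in> prec T" for x y z
        using that le_trans[of x y z] by (simp add: P_iff)
    qed
    show "antisym (prec T)"
    proof (rule antisymI)
      show "x = y" if "(x, y) \<in> prec T" "(y, x) \<in> prec T" for x y
        using that le_antisym[of x y] by (simp add: P_iff)
    qed
  qed (auto simp: P_iff)
  show "partition_on (hist T m) (choice T m j)" if "m \<in> moments T" for m j
    by (auto simp: partition_on_def disjoint_def)
  show "preorder_on (moments T) (rel T)" "preorder_on (moments T) (rel_e T)"
    by (auto simp: preorder_on_def refl_on_def epist_def intro!: transI)
  show "rel T \<subseteq> rel_e T" by simp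
  show "val T p \<subseteq> MH T" for p by (auto simp: MH_def)
  show "\<exists>m. (m, m1) \<in> prec T \<and> (m, m2) \<in> prec T" if "m1 \<in> moments T" "m2 \<in> moments T" for m1 m2
    using that root root_le by (auto simp: P_iff)
  show "(m1, m2) \<in> prec T \<or> (m2, m1) \<in> prec T" if "(m1, m) \<in> prec T" "(m2, m) \<in> prec T" for m1 m m2
    using that le_linear[of m1 m2 m] by (auto simp: P_iff)
  show "cell T m j h = cell T m j h'"
    if "m \<in> moments T" "h \<in> hist T m" "h' \<in> hist T m" "undivided T m h h'" for m h h' j
    using that cell_T L_undivided[of h m h'] by simp
  show "(\<Inter>j. f j) \<noteq> {}" if m: "m \<in> moments T" and f: "\<And>j. f j \<in> choice T m j" for m f
  proof -
    have "\<exists>h. h \<in> hs m \<and> f j = {h' \<in> hs m. unbox (Stit j) (L m h') = unbox (Stit j) (L m h)}" for j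
      using f[of j] by auto
    then have "\<forall>j. \<exists>h. h \<in> hs m \<and> f j = {h' \<in> hs m. unbox (Stit j) (L m h') = unbox (Stit j) (L m h)}"
      by (rule allI)
    from choice[OF this] obtain g where g: "g j \<in> hs m"
      "f j = {h' \<in> hs m. unbox (Stit j) (L m h') = unbox (Stit j) (L m (g j))}" for j
      by blast
    obtain h where "h \<in> hs m" "\<And>j. unbox (Stit j) (L m h) = unbox (Stit j) (L m (g j))"
      using L_independence[of m g] m g(1) by auto
    then have "h \<in> f j" for j using g(2)[of j] by simp
    then show ?thesis by blast
  qed
  show "evid T m t \<subseteq> evid T m' t" if "(m, m') \<in> rel_e T" for m m' t
    using evid_mono[of m m' t] that by auto
  show "B \<in> evid T m (Times s t)"
    if "m \<in> moments T" "Imp A B \<in> evid T m s" "A \<in> evid T m t" for m A B s t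
    using that evid_mp2[OF _ Ax[OF A4], of m s A B t] by simp
  show "evid T m s \<union> evid T m t \<subseteq> evid T m (Plus s t)" if "m \<in> moments T" for m s t
  proof -
    have "\<turnstile> Imp (Just s A) (Just (Plus s t) A)" "\<turnstile> Imp (Just t A) (Just (Plus s t) A)" for A :: "'a form"
      by (intro derivable_consequence[of "[Imp (Disj (Just s A) (Just t A)) (Just (Plus s t) A)]"];
          auto simp: Ax A6)+
    then show ?thesis using that evid_mp[of m] by auto
  qed
  show "Just t A \<in> evid T m (Bang t)" if "m \<in> moments T" "A \<in> evid T m t" for m A t
  proof -
    have "\<turnstile> Imp (Just t A) (Just (Bang t) (Just t A))"
      by (intro derivable_consequence[of "[Imp (Just t A) (Conj (Just (Bang t) (Just t A)) (Know A))]"])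
        (auto simp: Ax A5)
    then show ?thesis using that evid_mp[of m] by simp
  qed
  show "act T m' h \<subseteq> act T m h" if "(m', m) \<in> sprec T" "h \<in> hist T m" for m' m h
  proof -
    have W: "m' \<in> W" "m \<in> W" "le m' m" "m' \<noteq> m" and h: "h \<in> hs m"
      using that by (auto simp: sprec_T)
    \<comment> \<open>A moment with a strict predecessor is not the root, so
      \<open>settled_iff\<close> applies to what \<open>lab_settled\<close> puts into
      \<open>rep m\<close>.\<close>
    have "m \<noteq> root" using le_antisym[OF W(1,2,3)] root_le[OF W(1)] W(4) by blast
    moreover have "L m' h = lab m' m"
      using L_eq[OF hs_shift[OF h hs_downward[OF h W(1) hs_mem[OF h] W(3)]] hs_mem[OF h] W(3,4)] .
    ultimately show ?thesis
      using lab_settled[OF W] settled_iff[OF W(2)] h by auto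
  qed
  show "(\<Inter>h\<in>hist T m. act T m h) \<subseteq> (\<Union>m'\<in>{m'. (m', m) \<in> sprec T}. \<Union>h\<in>hist T m. act T m' h)"
    if "m \<in> moments T" for m
  proof
    fix t assume "t \<in> (\<Inter>h\<in>hist T m. act T m h)"
    then have *: "\<And>h. h \<in> hs m \<Longrightarrow> Ev t \<in> L m h" and m: "m \<in> W" using that by auto
    obtain x where x: "x \<in> W" "le x m" "x \<noteq> m" "Ev t \<in> lab x m"
      using settled_lab[OF m presented_settled[OF m *]] by blast
    obtain h where h: "h \<in> hs m" using hs_exists[OF m m le_refl[OF m]] by metis
    have "L x h = lab x m"
      using L_eq[OF hs_shift[OF h hs_downward[OF h x(1) hs_mem[OF h] x(2)]] hs_mem[OF h] x(2,3)] .
    then have "t \<in> act T x h" "(x, m) \<in> sprec T" using x m by (auto simp: sprec_T)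
    then show "t \<in> (\<Union>m'\<in>{m'. (m', m) \<in> sprec T}. \<Union>h\<in>hist T m. act T m' h)"
      using h by auto
  qed
  show "act T m h = act T m h'"
    if "m \<in> moments T" "h \<in> hist T m" "h' \<in> hist T m" "undivided T m h h'" for m h h'
    using that L_undivided[of h m h'] by simp
  show "prec T \<subseteq> rel T" using know_mono by (auto simp: P_def epist_def)
  show "(\<Inter>h\<in>hist T m. act T m h) \<subseteq> (\<Inter>h'\<in>hist T m'. act T m' h')" if "(m, m') \<in> rel_e T" for m m'
  proof
    fix t assume "t \<in> (\<Inter>h\<in>hist T m. act T m h)"
    then have *: "\<And>h. h \<in> hs m \<Longrightarrow> Ev t \<in> L m h" by auto
    have e: "(m, m') \<in> epist" and W: "m \<in> W" "m' \<in> W" using that by (auto simp: epist_def)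
    note m = presented_settled[OF W(1) *]
    have m': "m' \<noteq> root" using epist_not_root[OF e m(1)] .
    have "Know (Box (Ev t)) \<in> rep m" using mcs_axiom[OF rep_mcs[OF W(1) m(1)] A9 m(2)] .
    then have "Know (Box (Ev t)) \<in> rep m'" using e by (auto simp: epist_def unbox_def)
    then have "Box (Ev t) \<in> rep m'" using mcs_Know_imp[OF rep_mcs[OF W(2) m']] by blast
    then show "t \<in> (\<Inter>h'\<in>hist T m'. act T m' h')" using settled_iff[OF W(2) m'] by auto
  qed
qed

lemma normal_model_T: "normal_model T"
  by (auto simp: normal_model_def R3)

section \<open>The truth lemma\<close>

lemma know_class:
  assumes "h \<in> hs m" "m \<noteq> root"
  shows "Know A \<in> L m h \<longleftrightarrow> Know A \<in> rep m"
proof -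
  have "m \<in> W" using hs_W hs_mem assms(1) by blast
  from unbox_Know_box_class[OF L_class(1)[OF assms] rep_mcs[OF this assms(2)] L_class(2)[OF assms]]
  show ?thesis by (auto simp: unbox_def)
qed

text \<open>The refuting set must represent a moment other than the root, which is what
  \<open>rep_surj\<close> grants for every maximal consistent set, saturated or not.\<close>

lemma Know_L_iff:
  assumes h: "h \<in> hs m" and m: "m \<noteq> root"
  shows "Know A \<in> L m h \<longleftrightarrow> (\<forall>m'. (m, m') \<in> epist \<longrightarrow> (\<forall>h'\<in>hs m'. A \<in> L m' h'))"
proof
  assume K: "Know A \<in> L m h"
  show "\<forall>m'. (m, m') \<in> epist \<longrightarrow> (\<forall>h'\<in>hs m'. A \<in> L m' h')"
  proof (intro allI impI ballI)
    fix m' h' assume e: "(m, m') \<in> epist" and h': "h' \<in> hs m'"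
    have m': "m' \<noteq> root" using epist_not_root[OF e m] .
    have "Know A \<in> rep m" using K know_class[OF h m] by blast
    then have "Know A \<in> rep m'" using e by (auto simp: epist_def unbox_def)
    then have "Know A \<in> L m' h'" using know_class[OF h' m'] by blast
    then show "A \<in> L m' h'" using mcs_Know_imp[OF L_class(1)[OF h' m']] by blast
  qed
next
  assume *: "\<forall>m'. (m, m') \<in> epist \<longrightarrow> (\<forall>h'\<in>hs m'. A \<in> L m' h')"
  show "Know A \<in> L m h"
  proof (rule ccontr)
    assume "Know A \<notin> L m h"
    have mW: "m \<in> W" using hs_W[OF h hs_mem[OF h]] .
    note mcs = rep_mcs[OF mW m]
    have "Know A \<notin> rep m" using \<open>Know A \<notin> L m h\<close> know_class[OF h m] by blast
    from mcs_witness[OF normal_op_Know mcs this]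
    obtain \<Delta> where \<Delta>: "mcs \<Delta>" "unbox Know (rep m) \<subseteq> \<Delta>" "A \<notin> \<Delta>" .
    obtain m' where m': "m' \<in> W" "m' \<noteq> root" "rep m' = \<Delta>" using rep_surj[OF \<Delta>(1)] by blast
    have "(m, m') \<in> epist"
      using unbox_Know_mono[OF mcs \<Delta>(1,2)] mW m' by (simp add: epist_def)
    moreover obtain h' where "h' \<in> hs m'" "L m' h' = \<Delta>"
      using L_surj[OF m'(1,2) \<Delta>(1)] m'(3) by blast
    ultimately show False using * \<Delta>(3) by blast
  qed
qed

text \<open>Mirrors the semantic clause: since both epistemic relations are \<open>epist\<close>,
  its second half is the clause for \<open>Know\<close>.\<close>

lemma Just_L_iff:
  assumes h: "h \<in> hs m" and m: "m \<noteq> root"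
  shows "Just t A \<in> L m h \<longleftrightarrow> A \<in> evid T m t \<and> Know A \<in> L m h"
proof -
  have mW: "m \<in> W" using hs_W[OF h hs_mem[OF h]] .
  note mcs = L_class(1)[OF h m] rep_mcs[OF mW m]
  have k: "unbox Know (L m h) = unbox Know (rep m)"
    using unbox_Know_box_class[OF mcs L_class(2)[OF h m]] .
  have "Just t A \<in> L m h \<longleftrightarrow> Just t A \<in> rep m"
    using Just_unbox_Know[OF mcs] Just_unbox_Know[OF mcs(2,1)] k by blast
  then show ?thesis
    using evid_rep[OF mW m, of "Just t A"] mcs_Know_Just(2)[OF mcs(1), of t A] by auto
qed

lemma truth_lemma: "\<lbrakk>h \<in> hs m; m \<noteq> root\<rbrakk> \<Longrightarrow> holds T m h A \<longleftrightarrow> A \<in> L m h"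
proof (induction A arbitrary: m h)
  case (Atom p)
  then show ?case using hs_W[OF Atom(1) hs_mem[OF Atom(1)]] by simp
next
  case (Conj A B)
  then show ?case using mcs_Conj[OF L_class(1)] by simp
next
  case (Neg A)
  then show ?case using mcs_Neg[OF L_class(1)] by simp
next
  case (Stit j A)
  note h = Stit.prems(1) and m = Stit.prems(2)
  have mW: "m \<in> W" using hs_W[OF h hs_mem[OF h]] .
  note mcs = L_class(1)[OF h m]
  have "holds T m h (Stit j A) \<longleftrightarrow>
    (\<forall>h'\<in>hs m. unbox (Stit j) (L m h') = unbox (Stit j) (L m h) \<longrightarrow> A \<in> L m h')"
    using cell_T[OF h] Stit.IH[OF _ m] by auto
  also have "\<dots> \<longleftrightarrow> Stit j A \<in> L m h"
  proof
    assume "Stit j A \<in> L m h"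
    then show "\<forall>h'\<in>hs m. unbox (Stit j) (L m h') = unbox (Stit j) (L m h) \<longrightarrow> A \<in> L m h'"
      using S5_T[OF S5_op_Stit L_class(1)[OF _ m]] by (auto simp: unbox_def)
  next
    assume *: "\<forall>h'\<in>hs m. unbox (Stit j) (L m h') = unbox (Stit j) (L m h) \<longrightarrow> A \<in> L m h'"
    show "Stit j A \<in> L m h"
    proof (rule ccontr)
      assume "Stit j A \<notin> L m h"
      from S5_witness[OF S5_op_Stit mcs this]
      obtain \<Delta> where \<Delta>: "mcs \<Delta>" "unbox (Stit j) \<Delta> = unbox (Stit j) (L m h)" "A \<notin> \<Delta>" .
      \<comment> \<open>By (A2) a set with the same formulas \<open>Stit j B\<close> stays in the
        \<open>Box\<close>-class of the moment, so some history realises it.\<close>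
      have "unbox Box (L m h) \<subseteq> \<Delta>"
      proof
        fix B assume "B \<in> unbox Box (L m h)"
        then have "Stit j B \<in> L m h" using mcs_axiom[OF mcs A2] by (auto simp: unbox_def)
        then have "Stit j B \<in> \<Delta>" using \<Delta>(2) by (auto simp: unbox_def)
        then show "B \<in> \<Delta>" using S5_T[OF S5_op_Stit \<Delta>(1)] by blast
      qed
      from S5_unbox_eq[OF S5_op_Box mcs \<Delta>(1) this] L_class(2)[OF h m]
      have "unbox Box \<Delta> = unbox Box (rep m)" by simp
      from L_surj[OF mW m \<Delta>(1) this] obtain h' where "h' \<in> hs m" "L m h' = \<Delta>" .
      then show False using * \<Delta> by blast
    qed
  qed
  finally show ?case .
next
  case (Box A)
  note h = Box.prems(1) and m = Box.prems(2)
  have mW: "m \<in> W" using hs_W[OF h hs_mem[OF h]] .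
  have "holds T m h (Box A) \<longleftrightarrow> (\<forall>h'\<in>hs m. A \<in> L m h')" using Box.IH[OF _ m] by simp
  also have "\<dots> \<longleftrightarrow> Box A \<in> L m h"
    using settled_iff[OF mW m] L_class(2)[OF h m] by (auto simp: unbox_def)
  finally show ?case .
next
  case (Just t A)
  note h = Just.prems(1) and m = Just.prems(2)
  have "holds T m h (Just t A) \<longleftrightarrow>
    A \<in> evid T m t \<and> (\<forall>m'. (m, m') \<in> epist \<longrightarrow> (\<forall>h'\<in>hs m'. A \<in> L m' h'))"
    using Just.IH epist_not_root[OF _ m] by auto
  then show ?case using Know_L_iff[OF h m] Just_L_iff[OF h m] by blast
next
  case (Know A)
  note h = Know.prems(1) and m = Know.prems(2)
  have "holds T m h (Know A) \<longleftrightarrow> (\<forall>m'. (m, m') \<in> epist \<longrightarrow> (\<forall>h'\<in>hs m'. A \<in> L m' h'))"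
    using Know.IH epist_not_root[OF _ m] by auto
  then show ?case using Know_L_iff[OF h m] by blast
next
  case (Ev t)
  then show ?case by simp
qed

lemma mcs_satisfiable:
  assumes "mcs \<Gamma>"
  shows "satisfiable_in T \<Gamma>"
proof -
  obtain m where m: "m \<in> W" "m \<noteq> root" "rep m = \<Gamma>" using rep_surj[OF assms] by blast
  obtain h where h: "h \<in> hs m" "L m h = \<Gamma>" using L_surj[OF m(1,2) assms] m(3) by blast
  then have "\<forall>A\<in>\<Gamma>. holds T m h A" using truth_lemma[OF h(1) m(2)] by simp
  then show ?thesis using m(1) h(1) by (auto simp: satisfiable_in_def MH_def)
qed

end

section \<open>The tree of paths\<close>

text \<open>An entry \<open>((\<Gamma>, S), z)\<close> of a path is the decision to leave the previous moment along
  \<open>\<Gamma>\<close>, entering a copy of the chain of integers all of whose moments have the class of \<open>S\<close>,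
  together with the position \<open>z\<close> reached in this chain.\<close>

type_synonym 'a entry = "('a form set \<times> 'a form set) \<times> int"

text \<open>Besides the prefixes of a path, those below it arise by cutting it after some entry and
  lowering the position in that entry.\<close>

fun path_le :: "('b \<times> int) list \<Rightarrow> ('b \<times> int) list \<Rightarrow> bool" where
  "path_le [] ys \<longleftrightarrow> True"
| "path_le (x # xs) [] \<longleftrightarrow> False"
| "path_le (x # xs) (y # ys) \<longleftrightarrow>
    x = y \<and> path_le xs ys \<or> xs = [] \<and> fst x = fst y \<and> snd x < snd y"

text \<open>A proper prefix is left along the set \<Gamma> of the next entry. If the last entry of
  the first path differs only in its position, the second path moves up the chain and the label is
  S. Values for paths not in strict order are arbitrary.\<close>

fun lab_path :: "'a entry list \<Rightarrow> 'a entry list \<Rightarrow> 'a form set" where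
  "lab_path [] (y # ys) = fst (fst y)"
| "lab_path (x # xs) (y # ys) = (if x = y then lab_path xs ys else snd (fst x))"
| "lab_path xs [] = {}"

primrec rep_path :: "'a form set \<Rightarrow> 'a entry list \<Rightarrow> 'a form set" where
  "rep_path R [] = R"
| "rep_path R (e # es) = rep_path (snd (fst e)) es"

text \<open>The empty set serves as the representative of the root. First entries are special: their
  class need not be saturated, so that every class occurs, and hence \<open>z\<close> cannot vary.\<close>

definition step :: "'a form set \<Rightarrow> 'a entry \<Rightarrow> bool" where
  "step R e \<longleftrightarrow> (case e of ((\<Gamma>, S), z) \<Rightarrow> mcs S \<and>
    (if R = {} then \<Gamma> = {Ev t |t. Box (Ev t) \<in> S} \<and> z = 0
     else mcs \<Gamma> \<and> unbox Box \<Gamma> = unbox Box R \<and> saturated S \<and>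
       unbox Know \<Gamma> \<subseteq> unbox Know S \<and> (\<forall>t. Ev t \<in> \<Gamma> \<longrightarrow> Box (Ev t) \<in> S)))"

primrec path :: "'a form set \<Rightarrow> 'a entry list \<Rightarrow> bool" where
  "path R [] \<longleftrightarrow> True"
| "path R (e # es) \<longleftrightarrow> step R e \<and> path (snd (fst e)) es"

section \<open>Order and labels of paths\<close>

lemma path_le_refl: "path_le xs xs"
  by (induction xs) auto

lemma path_le_Nil [simp]: "path_le xs [] \<longleftrightarrow> xs = []"
  by (cases xs) auto

lemma path_le_trans: "\<lbrakk>path_le xs ys; path_le ys zs\<rbrakk> \<Longrightarrow> path_le xs zs"
proof (induction xs ys arbitrary: zs rule: path_le.induct)
  case (3 x xs y ys)
  from 3(3) obtain z zs' where "zs = z # zs'" by (cases zs) auto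
  with 3 show ?case by auto
qed auto

lemma path_le_antisym: "\<lbrakk>path_le xs ys; path_le ys xs\<rbrakk> \<Longrightarrow> xs = ys"
  by (induction xs ys rule: path_le.induct) auto

lemma path_le_linear: "\<lbrakk>path_le xs zs; path_le ys zs\<rbrakk> \<Longrightarrow> path_le xs ys \<or> path_le ys xs"
proof (induction xs ys arbitrary: zs rule: path_le.induct)
  case (3 x xs y ys)
  from 3(2) obtain z zs' where zs: "zs = z # zs'" by (cases zs) auto
  have "path_le xs ys \<or> path_le ys xs" if "path_le xs zs'" "path_le ys zs'"
    using 3(1)[OF that] .
  with 3(2,3) zs show ?case by (cases "snd x" "snd y" rule: linorder_cases) (auto simp: prod_eq_iff)
qed auto

lemma path_le_append: "path_le xs (xs @ ys)"
  by (induction xs) auto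

lemma path_le_last: "z < z' \<Longrightarrow> path_le (xs @ [(c, z)]) (xs @ [(c, z')])"
  by (induction xs) auto

lemma lab_path_append: "lab_path xs (xs @ [e]) = fst (fst e)"
  by (induction xs) auto

lemma lab_path_last: "e \<noteq> e' \<Longrightarrow> lab_path (xs @ [e]) (xs @ [e']) = snd (fst e)"
  by (induction xs) auto

lemma lab_path_local:
  "\<lbrakk>path_le xs ys; xs \<noteq> ys; path_le ys zs\<rbrakk> \<Longrightarrow> lab_path xs zs = lab_path xs ys"
proof (induction xs ys arbitrary: zs rule: path_le.induct)
  case (1 ys)
  then obtain y ys' where ys: "ys = y # ys'" by (cases ys) auto
  then obtain z zs' where "zs = z # zs'" using 1(3) by (cases zs) auto
  with 1 ys show ?case by auto
next
  case (3 x xs y ys)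
  from 3(4) obtain z zs' where "zs = z # zs'" by (cases zs) auto
  with 3 show ?case by auto
qed auto

lemma rep_path_append [simp]: "rep_path R (xs @ ys) = rep_path (rep_path R xs) ys"
  by (induction xs arbitrary: R) auto

lemma path_append [simp]: "path R (xs @ ys) \<longleftrightarrow> path R xs \<and> path (rep_path R xs) ys"
  by (induction xs arbitrary: R) auto

section \<open>Classes, knowledge and settled proofs along paths\<close>

lemma mcs_nonempty: "mcs \<Gamma> \<Longrightarrow> \<Gamma> \<noteq> {}"
  by (auto simp: mcs_def)

lemma step_mcs: "step R e \<Longrightarrow> mcs (snd (fst e))"
  by (auto simp: step_def split: prod.splits)

lemma step_lab:
  "\<lbrakk>step R e; R \<noteq> {}\<rbrakk> \<Longrightarrow> mcs (fst (fst e)) \<and> unbox Box (fst (fst e)) = unbox Box R"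
  by (auto simp: step_def split: prod.splits)

lemma step_settled: "\<lbrakk>step R e; Ev t \<in> fst (fst e)\<rbrakk> \<Longrightarrow> Box (Ev t) \<in> snd (fst e)"
  by (auto simp: step_def split: prod.splits if_splits)

lemma step_know:
  assumes "step R e" "R = {} \<or> mcs R"
  shows "unbox Know R \<subseteq> unbox Know (snd (fst e))"
proof (cases "R = {}")
  case True
  then show ?thesis by (simp add: unbox_def)
next
  case False
  note e = step_lab[OF assms(1) False]
  have "unbox Know R = unbox Know (fst (fst e))"
    using unbox_Know_box_class[of R "fst (fst e)"] e assms(2) False by simp
  moreover have "unbox Know (fst (fst e)) \<subseteq> unbox Know (snd (fst e))"
    using assms(1) False by (cases e) (simp add: step_def case_prod_beta)
  ultimately show ?thesis by simp
qed

text \<open>First entries, whose class may be unsaturated, all have position 0; two different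
  positions thus occur only in the saturated case.\<close>

lemma step_saturated: "\<lbrakk>step R x; step R y; snd x < snd y\<rbrakk> \<Longrightarrow> saturated (snd (fst x))"
  by (cases "R = {}") (simp_all add: step_def case_prod_beta)

lemma rep_path_mcs: "\<lbrakk>path R xs; xs \<noteq> [] \<or> mcs R\<rbrakk> \<Longrightarrow> mcs (rep_path R xs)"
proof (induction xs arbitrary: R)
  case (Cons e es)
  then show ?case using step_mcs[of R e] by simp
qed simp

lemma lab_path_class:
  "\<lbrakk>path R xs; path R ys; path_le xs ys; xs \<noteq> ys; R \<noteq> {} \<or> xs \<noteq> []\<rbrakk>
    \<Longrightarrow> mcs (lab_path xs ys) \<and> unbox Box (lab_path xs ys) = unbox Box (rep_path R xs)"
proof (induction xs ys arbitrary: R rule: path_le.induct)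
  case (1 ys)
  then obtain y ys' where "ys = y # ys'" by (cases ys) auto
  with 1 show ?case using step_lab[of R y] by simp
next
  case (3 x xs y ys)
  then have x: "mcs (snd (fst x))" using step_mcs[of R x] by simp
  note IH = 3(1)
  show ?case
  proof (cases "x = y")
    case True
    with 3 show ?thesis using mcs_nonempty[OF x] IH[of "snd (fst x)"] by auto
  next
    case False
    with 3 show ?thesis using x by auto
  qed
qed auto

lemma rep_path_know:
  "\<lbrakk>path R xs; R = {} \<or> mcs R\<rbrakk> \<Longrightarrow> unbox Know R \<subseteq> unbox Know (rep_path R xs)"
proof (induction xs arbitrary: R)
  case (Cons e es)
  then have "unbox Know R \<subseteq> unbox Know (snd (fst e))" "mcs (snd (fst e))"
    using step_know[of R e] step_mcs[of R e] by auto
  moreover have "unbox Know (snd (fst e)) \<subseteq> unbox Know (rep_path (snd (fst e)) es)"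
    using Cons.IH Cons.prems(1) calculation(2) by simp
  ultimately show ?case by simp
qed simp

lemma path_le_know:
  "\<lbrakk>path R xs; path R ys; path_le xs ys; R = {} \<or> mcs R\<rbrakk>
    \<Longrightarrow> unbox Know (rep_path R xs) \<subseteq> unbox Know (rep_path R ys)"
proof (induction xs ys arbitrary: R rule: path_le.induct)
  case (1 ys)
  then show ?case using rep_path_know by simp
next
  case (3 x xs y ys)
  then have "mcs (snd (fst x))" "mcs (snd (fst y))" using step_mcs[of R x] step_mcs[of R y] by auto
  with 3 show ?case using rep_path_know[of "snd (fst y)" ys] by auto
qed auto

text \<open>By (A9) a settled proof is known to be settled, and knowledge only grows along a
  path.\<close>

lemma rep_path_Box_Ev:
  assumes "path S xs" "mcs S" "Box (Ev t) \<in> S"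
  shows "Box (Ev t) \<in> rep_path S xs"
proof -
  have "Know (Box (Ev t)) \<in> S" using mcs_axiom[OF assms(2) A9 assms(3)] .
  then have "Know (Box (Ev t)) \<in> rep_path S xs"
    using rep_path_know[OF assms(1)] assms(2) by (auto simp: unbox_def)
  then show ?thesis using mcs_Know_imp rep_path_mcs[OF assms(1)] assms(2) by blast
qed

text \<open>When the path branches off, \<open>step\<close> demands that the proofs presented in
  \<Gamma> be settled; when it moves up a chain, saturation of S settles them. Settled proofs then
  persist to the end of \<open>ys\<close>.\<close>

lemma lab_path_settled:
  "\<lbrakk>path R xs; path R ys; path_le xs ys; xs \<noteq> ys; Ev t \<in> lab_path xs ys\<rbrakk>
    \<Longrightarrow> Box (Ev t) \<in> rep_path R ys"
proof (induction xs ys arbitrary: R rule: path_le.induct)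
  case (1 ys)
  then obtain y ys' where ys: "ys = y # ys'" by (cases ys) auto
  with 1 have "mcs (snd (fst y))" "Box (Ev t) \<in> snd (fst y)"
    using step_mcs[of R y] step_settled[of R y t] by auto
  with 1 ys show ?case using rep_path_Box_Ev[of "snd (fst y)" ys' t] by simp
next
  case (3 x xs y ys)
  then have y: "mcs (snd (fst y))" "path (snd (fst y)) ys" using step_mcs[of R y] by auto
  show ?case
  proof (cases "x = y")
    case True
    with 3 show ?thesis by auto
  next
    case False
    with 3 have "fst x = fst y" "saturated (snd (fst x))" "Ev t \<in> snd (fst x)"
      using step_saturated[of R x y] by auto
    then have "Box (Ev t) \<in> snd (fst y)" by (simp add: saturated_def)
    then show ?thesis using rep_path_Box_Ev[OF y(2,1)] by simp
  qed
qed auto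

text \<open>Chains have no least position, so a proof presented at a moment of a chain has been
  presented before; this would fail with immediate successors.\<close>

lemma rep_path_settled:
  assumes ys: "path {} ys" "ys \<noteq> []" and t: "Box (Ev t) \<in> rep_path {} ys"
  obtains xs where "path {} xs" "path_le xs ys" "xs \<noteq> ys" "Ev t \<in> lab_path xs ys"
proof -
  obtain p e where e: "ys = p @ [e]" using ys(2) by (metis rev_exhaust)
  obtain \<Gamma> S z where eq: "e = ((\<Gamma>, S), z)" by (metis surj_pair)
  show thesis
  proof (cases "p = []")
    case True
    \<comment> \<open>A first entry has only the root before it, whose label presents exactly the
      proofs settled in \<open>S\<close>.\<close>
    then show thesis using that[of "[]"] ys t e eq by (auto simp: step_def)
  next
    case False
    let ?xs = "p @ [((\<Gamma>, S), z - 1)]"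
    have "rep_path {} p \<noteq> {}"
      using rep_path_mcs[of "{}" p] ys(1) e False mcs_nonempty by auto
    then have "path {} ?xs" using ys(1) e eq by (simp add: step_def)
    moreover have "path_le ?xs ys" using path_le_last[of "z - 1" z] e eq by simp
    moreover have "Ev t \<in> S"
      using S5_T[OF S5_op_Box rep_path_mcs[OF ys(1)] t] ys(2) e eq by simp
    then have "Ev t \<in> lab_path ?xs ys" using lab_path_last[of "((\<Gamma>, S), z - 1)" e p] e eq by simp
    ultimately show thesis using that[of ?xs] e eq by simp
  qed
qed

lemma path_singleton: "mcs S \<Longrightarrow> path {} [(({Ev t |t. Box (Ev t) \<in> S}, S), 0)]"
  by (simp add: step_def)

text \<open>The injection \<open>c\<close> transports the tree of paths to the prescribed type of
  moments; \<open>inv c\<close> decodes.\<close>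

lemma labelled_tree_paths:
  fixes c :: "'a::finite entry list \<Rightarrow> 'w"
  assumes "inj c"
  shows "labelled_tree (c ` {xs. path {} xs}) (\<lambda>x y. path_le (inv c x) (inv c y)) (c [])
    (\<lambda>x. rep_path {} (inv c x)) (\<lambda>x y. lab_path (inv c x) (inv c y))"
proof -
  have inv [simp]: "inv c (c xs) = xs" for xs using assms by simp
  have eq [simp]: "c xs = c ys \<longleftrightarrow> xs = ys" for xs ys using assms by (auto dest: injD)
  show ?thesis
  proof (unfold_locales, goal_cases)
    case (3 x y z)
    then show ?case using path_le_trans by blast
  next
    case (4 x y z)
    then show ?case using path_le_linear by blast
  next
    case (8 x)
    then show ?case using rep_path_mcs[of "{}" "inv c x"] by auto
  next
    case (9 S)
    then show ?case
      by (intro bexI[of _ "c [(({Ev t |t. Box (Ev t) \<in> S}, S), 0)]"]) (auto simp: step_def)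
  next
    case (10 x y z)
    then show ?case using lab_path_local[of "inv c x" "inv c y" "inv c z"] by auto
  next
    case (11 x y)
    then show ?case using lab_path_class[of "{}" "inv c x" "inv c y"] by auto
  next
    case (12 x \<Gamma>)
    then obtain xs where xs: "x = c xs" "path {} xs" "xs \<noteq> []" by auto
    obtain S where S: "mcs S" "saturated S" "unbox Know \<Gamma> \<subseteq> unbox Know S"
      "\<And>t. Ev t \<in> \<Gamma> \<Longrightarrow> Box (Ev t) \<in> S" using saturated_successor[OF 12(3)] by metis
    have "rep_path {} xs \<noteq> {}" using rep_path_mcs[OF xs(2)] xs(3) mcs_nonempty by blast
    \<comment> \<open>The position 0 is arbitrary: beyond the first entry, \<open>step\<close>
      leaves the integer free.\<close>
    then have "path {} (xs @ [((\<Gamma>, S), 0)])" using xs S 12(3,4) by (simp add: step_def)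
    then show ?case using xs(1)
      by (intro bexI[of _ "c (xs @ [((\<Gamma>, S), 0)])"]) (auto simp: path_le_append lab_path_append)
  next
    case (13 x y)
    then show ?case using path_le_know[of "{}" "inv c x" "inv c y"] by auto
  next
    case (14 x y t)
    then show ?case using lab_path_settled[of "{}" "inv c x" "inv c y" t] by auto
  next
    case (15 y t)
    then obtain ys where ys: "y = c ys" "path {} ys" "ys \<noteq> []" "Box (Ev t) \<in> rep_path {} ys" by auto
    then obtain xs where "path {} xs" "path_le xs ys" "xs \<noteq> ys" "Ev t \<in> lab_path xs ys"
      using rep_path_settled by metis
    then show ?case using ys(1) by (intro bexI[of _ "c xs"]) auto
  next
    case (16 t)
    obtain S :: "'a form set" where S: "{Neg (Ev t)} \<subseteq> S" "mcs S" using lindenbaum[OF con_Neg_Ev] by metis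
    then have "Box (Ev t) \<notin> S" using S5_T[OF S5_op_Box S(2)] mcs_Neg[OF S(2)] by blast
    then show ?case using path_singleton[OF S(2)]
      by (intro bexI[of _ "c [(({Ev t |t. Box (Ev t) \<in> S}, S), 0)]"]) auto
  next
    case (17 y j)
    then obtain ys where ys: "y = c ys" "path {} ys" "ys \<noteq> []" by auto
    then obtain e es where "ys = e # es" by (cases ys) auto
    then show ?case using ys by (cases e) (auto simp: step_def unbox_def)
  qed (auto simp: path_le_refl dest: path_le_antisym)
qed

section \<open>Encoding paths by sets of natural numbers\<close>

instance pol :: countable
  by countable_datatype

instance form :: (countable) countable
  by countable_datatype

definition join :: "nat set \<Rightarrow> nat set \<Rightarrow> nat set" where
  "join X Y = (\<lambda>n. 2 * n) ` X \<union> (\<lambda>n. 2 * n + 1) ` Y"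

lemma join_inject: "join X Y = join X' Y' \<longleftrightarrow> X = X' \<and> Y = Y'"
proof
  assume eq: "join X Y = join X' Y'"
  have even: "2 * n \<in> join A B \<longleftrightarrow> n \<in> A" for n A B
  proof -
    have "2 * n \<noteq> 2 * k + 1" for k by presburger
    then show ?thesis by (auto simp: join_def)
  qed
  have odd: "2 * n + 1 \<in> join A B \<longleftrightarrow> n \<in> B" for n A B
  proof -
    have "2 * n + 1 \<noteq> 2 * k" for k by presburger
    then show ?thesis by (auto simp: join_def)
  qed
  have "n \<in> X \<longleftrightarrow> n \<in> X'" "n \<in> Y \<longleftrightarrow> n \<in> Y'" for n
    using even[of n X Y] even[of n X' Y'] odd[of n X Y] odd[of n X' Y'] eq by simp_all
  then show "X = X' \<and> Y = Y'" by blast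
qed simp

definition code_entry :: "'a::finite entry \<Rightarrow> nat set" where
  "code_entry e = join (join (to_nat ` fst (fst e)) (to_nat ` snd (fst e))) {to_nat (snd e)}"

text \<open>The tail is shifted and marked by 0, so that a nonempty path never receives the code
  \<open>{}\<close> of the empty one.\<close>

primrec code_path :: "'a::finite entry list \<Rightarrow> nat set" where
  "code_path [] = {}"
| "code_path (e # es) = join (code_entry e) (insert 0 (Suc ` code_path es))"

lemma code_entry_inject: "code_entry e = code_entry e' \<longleftrightarrow> e = e'"
  by (simp add: code_entry_def join_inject inj_image_eq_iff[OF inj_to_nat] prod_eq_iff)

lemma inj_code_path: "inj code_path"
proof (rule injI)
  fix xs ys :: "'a entry list" assume "code_path xs = code_path ys"
  then show "xs = ys"
  proof (induction xs arbitrary: ys)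
    case Nil
    then show ?case by (cases ys) (auto simp: join_def)
  next
    case (Cons x xs)
    then obtain y ys' where ys: "ys = y # ys'" by (cases ys) (auto simp: join_def)
    have "insert 0 (Suc ` A) = insert 0 (Suc ` B) \<longleftrightarrow> A = B" for A B by auto
    then show ?case using Cons ys by (simp add: join_inject code_entry_inject)
  qed
qed

section \<open>Completeness\<close>

text \<open>\<open>embed\<close> gives \<open>'w\<close> room for the codes of all paths. Both
  epistemic relations of \<open>T\<close> are \<open>epist\<close>, so the model is unirelational by
  construction.\<close>

lemma consistent_satisfiable:
  fixes \<Gamma> :: "'a::finite form set" and embed :: "nat set \<Rightarrow> 'w"
  assumes "inj embed" "consistent \<Gamma>"
  shows "\<exists>M :: ('a, 'w) jstit.
    jstit_model M \<and> normal_model M \<and> unirelational M \<and> satisfiable_in M \<Gamma>"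
proof -
  obtain \<Delta> where \<Delta>: "\<Gamma> \<subseteq> \<Delta>" "mcs \<Delta>" using lindenbaum[OF consistent_con[OF assms(2)]] .
  define c :: "'a entry list \<Rightarrow> 'w" where "c = embed \<circ> code_path"
  have "inj c" unfolding c_def by (rule inj_compose[OF assms(1) inj_code_path])
  then interpret labelled_tree "c ` {xs. path {} xs}" "\<lambda>x y. path_le (inv c x) (inv c y)" "c []"
    "\<lambda>x. rep_path {} (inv c x)" "\<lambda>x y. lab_path (inv c x) (inv c y)"
    by (rule labelled_tree_paths)
  have "unirelational T" by (simp add: unirelational_def)
  moreover have "satisfiable_in T \<Gamma>"
    using mcs_satisfiable[OF \<Delta>(2)] \<Delta>(1) by (auto simp: satisfiable_in_def)
  ultimately show ?thesis using jstit_model_T normal_model_T by blast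
qed

theorem theorem2:
  fixes \<Gamma> :: "'a::finite form set"
    and embed :: "nat set \<Rightarrow> 'w"
  assumes "inj embed"
  shows "(consistent \<Gamma> \<longleftrightarrow>
            (\<exists>M :: ('a, 'w) jstit.
              jstit_model M \<and> normal_model M \<and> satisfiable_in M \<Gamma>)) \<and>
         (consistent \<Gamma> \<longleftrightarrow>
            (\<exists>M :: ('a, 'w) jstit.
              jstit_model M \<and> normal_model M \<and> unirelational M \<and> satisfiable_in M \<Gamma>))"
proof -
  have "consistent \<Gamma>" if "jstit_model M" "normal_model M" "satisfiable_in M \<Gamma>"
    for M :: "('a, 'w) jstit"
    using jstit_model.satisfiable_consistent[OF that] .
  then show ?thesis using consistent_satisfiable[OF assms, of \<Gamma>] by blast
qed

end
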